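(* Let $\mathfrak g$ be a nilpotent almost abelian Lie algebra of dimension $2n+2$, with codimension one abelian ideal $\mathfrak a$ and with a complex structure $J$. Let $n=\sum_{i>0}q_i\cdot i$ and $j$ be the associated partition of $n$ and the size of the overlapping block (see context). Then there exists a basis $e_0,\dots,e_{2n+1}$ of $\mathfrak g$ with respect to which $\mathfrak a=\langle e_1,\dots,e_{2n+1}\rangle$, the adjoint action $\phi=\mathrm{ad}_{e_0}|_{\mathfrak a}$ is represented by the matrix $$A=\begin{pmatrix}0&0\\ v&\tilde B\end{pmatrix}\in \mathsf M_{2n+1}(\mathbb R),\qquad v=\begin{pmatrix}\epsilon\\0\\ \vdots\\0\end{pmatrix},\qquad \tilde B=\begin{pmatrix}B&\\&B\end{pmatrix},$$ where $\epsilon=1$ if $j>1$ and $\epsilon=0$ if $j=1$, and the complex structure $J$ is represented by the matrix $$J_0=\begin{pmatrix}0&-1&&\\1&0&&\\&&0&-I_n\\&&I_n&0\end{pmatrix}\in\mathsf M_{2n+2}(\mathbb R).$$ In particular, if a nilpotent almost abelian Lie algebra admits a complex structure, then the complex structure is unique up to Lie algebra isomorphism (i.e. for any two complex structures $J,J'$ on $\mathfrak g$ there is a Lie algebra automorphism $\psi$ of $\mathfrak g$ with $\psi J=J'\psi$).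
   Context: A non-abelian finite-dimensional real Lie algebra $\mathfrak g$ is almost abelian if it has a codimension one abelian ideal $\mathfrak a$. A complex structure on $\mathfrak g$ is an endomorphism $J$ with $J^2=-\mathrm{id}$ and vanishing Nijenhuis tensor. The Jordan partition of a nilpotent almost abelian Lie algebra $\mathfrak g$ of dimension $2n+2$ is the partition $2n+1=\sum_{i>0}m_i\cdot i$ given by the sizes of the Jordan blocks of $\mathrm{ad}_{x}|_{\mathfrak a}$ for any $x\in\mathfrak g\setminus\mathfrak a$ ($m_i$ blocks of size $i$). It determines $\mathfrak g$ up to isomorphism. Known fact (defining the notation): $\mathfrak g$ admits a complex structure if and only if there exist a partition $n=\sum_{i>0}q_i\cdot i$, $q_i\ge0$, and an index $j>0$ such that either $j=1$ and $m_1=2q_1+1$, $m_i=2q_i$ for $i>1$; or $j>1$, $q_{j-1}>0$, and $m_j=2q_j+1$, $m_{j-1}=2q_{j-1}-1$, $m_i=2q_i$ for $i\ne j,j-1$. The $q_i$ and $j$ are then determined by the $m_i$; $j$ is called the size of the overlapping block. In the claim, $B\in\mathsf M_n(\mathbb Z)$ is a lower triangular nilpotent matrix in Jordan normal form (block diagonal, with Jordan blocks having $1$'s on the subdiagonal and $0$ elsewhere) with exactly $q_i$ blocks of size $i$ for each $i$, such that if $j>1$ the first block has size $j-1$; apart from this the order of the blocks is arbitrary. *)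

theory Defs
  imports "HOL-Analysis.Analysis" "Jordan_Normal_Form.Jordan_Normal_Form"
begin

subsection \<open>Real Lie algebras\<close>

text \<open>The underlying vector space of the Lie algebra is the whole type.\<close>

locale real_lie_algebra =
  fixes br :: "'a::real_vector \<Rightarrow> 'a \<Rightarrow> 'a"
  assumes bilinear: "bilinear br"
    and alternating: "br x x = 0"
    and jacobi: "br x (br y z) + br y (br z x) + br z (br x y) = 0"

definition lie_ideal :: "('a::real_vector \<Rightarrow> 'a \<Rightarrow> 'a) \<Rightarrow> 'a set \<Rightarrow> bool" where
  "lie_ideal br I \<longleftrightarrow> subspace I \<and> (\<forall>x. \<forall>y\<in>I. br x y \<in> I)"

definition abelian_on :: "('a::real_vector \<Rightarrow> 'a \<Rightarrow> 'a) \<Rightarrow> 'a set \<Rightarrow> bool" where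
  "abelian_on br S \<longleftrightarrow> (\<forall>x\<in>S. \<forall>y\<in>S. br x y = 0)"

fun lower_central :: "('a::real_vector \<Rightarrow> 'a \<Rightarrow> 'a) \<Rightarrow> nat \<Rightarrow> 'a set" where
  "lower_central br 0 = UNIV"
| "lower_central br (Suc k) = span {br x y | x y. y \<in> lower_central br k}"

definition nilpotent_lie :: "('a::real_vector \<Rightarrow> 'a \<Rightarrow> 'a) \<Rightarrow> bool" where
  "nilpotent_lie br \<longleftrightarrow> (\<exists>k. lower_central br k = {0})"

definition codim_one_abelian_ideal :: "('a::real_vector \<Rightarrow> 'a \<Rightarrow> 'a) \<Rightarrow> 'a set \<Rightarrow> bool" where
  "codim_one_abelian_ideal br I \<longleftrightarrow>
     lie_ideal br I \<and> abelian_on br I \<and> dim I + 1 = dim (UNIV :: 'a set)"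

definition almost_abelian :: "('a::real_vector \<Rightarrow> 'a \<Rightarrow> 'a) \<Rightarrow> bool" where
  "almost_abelian br \<longleftrightarrow>
     real_lie_algebra br \<and> (\<exists>S::'a set. finite S \<and> span S = UNIV) \<and>
     \<not> abelian_on br UNIV \<and> (\<exists>I. codim_one_abelian_ideal br I)"

definition nijenhuis :: "('a::real_vector \<Rightarrow> 'a \<Rightarrow> 'a) \<Rightarrow> ('a \<Rightarrow> 'a) \<Rightarrow> 'a \<Rightarrow> 'a \<Rightarrow> 'a" where
  "nijenhuis br J x y = br (J x) (J y) - J (br (J x) y) - J (br x (J y)) - br x y"

definition complex_structure :: "('a::real_vector \<Rightarrow> 'a \<Rightarrow> 'a) \<Rightarrow> ('a \<Rightarrow> 'a) \<Rightarrow> bool" where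
  "complex_structure br J \<longleftrightarrow>
     linear J \<and> (\<forall>x. J (J x) = - x) \<and> (\<forall>x y. nijenhuis br J x y = 0)"

definition lie_automorphism :: "('a::real_vector \<Rightarrow> 'a \<Rightarrow> 'a) \<Rightarrow> ('a \<Rightarrow> 'a) \<Rightarrow> bool" where
  "lie_automorphism br \<psi> \<longleftrightarrow>
     linear \<psi> \<and> bij \<psi> \<and> (\<forall>x y. \<psi> (br x y) = br (\<psi> x) (\<psi> y))"

subsection \<open>Bases, matrices and Jordan blocks\<close>

text \<open>The basis vectors are \<open>e 0, \<dots>, e (N - 1)\<close>; values of \<open>e\<close> beyond are irrelevant.\<close>

definition basis_of :: "'a::real_vector set \<Rightarrow> nat \<Rightarrow> (nat \<Rightarrow> 'a) \<Rightarrow> bool" where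
  "basis_of V N e \<longleftrightarrow>
     inj_on e {..<N} \<and> independent (e ` {..<N}) \<and> span (e ` {..<N}) = V"

text \<open>Matrices act on column vectors: column \<open>k\<close> holds the coordinates of \<open>f (e k)\<close>.\<close>

definition represented_by :: "nat \<Rightarrow> (nat \<Rightarrow> 'a::real_vector) \<Rightarrow> ('a \<Rightarrow> 'a) \<Rightarrow> real mat \<Rightarrow> bool" where
  "represented_by N e f M \<longleftrightarrow>
     M \<in> carrier_mat N N \<and> (\<forall>k<N. f (e k) = (\<Sum>i<N. M $$ (i, k) *\<^sub>R e i))"

text \<open>\<open>m i\<close> is the number of blocks of size \<open>i\<close> in a real Jordan normal form of \<open>f\<close> on \<open>V\<close>.\<close>

definition jordan_block_counts :: "'a::real_vector set \<Rightarrow> ('a \<Rightarrow> 'a) \<Rightarrow> (nat \<Rightarrow> nat) \<Rightarrow> bool" where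
  "jordan_block_counts V f m \<longleftrightarrow>
     (\<exists>e M n_as. basis_of V (dim V) e \<and> represented_by (dim V) e f M \<and>
        jordan_nf M n_as \<and> (\<forall>i. m i = count_list (map fst n_as) i))"

definition jordan_partition ::
    "('a::real_vector \<Rightarrow> 'a \<Rightarrow> 'a) \<Rightarrow> 'a set \<Rightarrow> (nat \<Rightarrow> nat) \<Rightarrow> bool" where
  "jordan_partition br I m \<longleftrightarrow> (\<forall>x. x \<notin> I \<longrightarrow> jordan_block_counts I (br x) m)"

text \<open>\<open>q i\<close> is the multiplicity of the part \<open>i\<close>.\<close>

definition is_partition :: "nat \<Rightarrow> (nat \<Rightarrow> nat) \<Rightarrow> bool" where
  "is_partition n q \<longleftrightarrow> (\<forall>i. q i \<noteq> 0 \<longrightarrow> 1 \<le> i \<and> i \<le> n) \<and> (\<Sum>i=1..n. q i * i) = n"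

definition associated_partition :: "(nat \<Rightarrow> nat) \<Rightarrow> nat \<Rightarrow> (nat \<Rightarrow> nat) \<Rightarrow> nat \<Rightarrow> bool" where
  "associated_partition m n q j \<longleftrightarrow> is_partition n q \<and>
     (j = 1 \<and> m 1 = 2 * q 1 + 1 \<and> (\<forall>i>1. m i = 2 * q i) \<or>
      j > 1 \<and> q (j - 1) > 0 \<and> m j = 2 * q j + 1 \<and> m (j - 1) = 2 * q (j - 1) - 1 \<and>
        (\<forall>i>0. i \<noteq> j \<and> i \<noteq> j - 1 \<longrightarrow> m i = 2 * q i))"

text \<open>\<^const>\<open>jordan_matrix\<close> has its \<open>1\<close>'s on the superdiagonal, hence the transpose.\<close>

definition nilpotent_lower_jordan :: "nat list \<Rightarrow> int mat" where
  "nilpotent_lower_jordan ns = transpose_mat (jordan_matrix (map (\<lambda>k. (k, 0)) ns))"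

definition admissible_B :: "(nat \<Rightarrow> nat) \<Rightarrow> nat \<Rightarrow> int mat \<Rightarrow> bool" where
  "admissible_B q j B \<longleftrightarrow>
     (\<exists>ns. 0 \<notin> set ns \<and> (\<forall>i>0. count_list ns i = q i) \<and>
        (j > 1 \<longrightarrow> ns \<noteq> [] \<and> hd ns = j - 1) \<and> B = nilpotent_lower_jordan ns)"

definition ad_matrix :: "nat \<Rightarrow> nat \<Rightarrow> int mat \<Rightarrow> real mat" where
  "ad_matrix n j B =
     (let \<epsilon> = (if j > 1 then 1 else 0);
          B' = map_mat real_of_int B;
          v = mat (2 * n) 1 (\<lambda>(i, _). if i = 0 then \<epsilon> else 0)
      in four_block_mat (0\<^sub>m 1 1) (0\<^sub>m 1 (2 * n))
                        v (four_block_mat B' (0\<^sub>m n n) (0\<^sub>m n n) B'))"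

definition J0_matrix :: "nat \<Rightarrow> real mat" where
  "J0_matrix n =
     four_block_mat
       (mat_of_rows_list 2 [[0, -1], [1, 0]]) (0\<^sub>m 2 (2 * n))
       (0\<^sub>m (2 * n) 2) (four_block_mat (0\<^sub>m n n) (- 1\<^sub>m n) (1\<^sub>m n) (0\<^sub>m n n))"

end

theory Submission
  imports Defs "Jordan_Normal_Form.Jordan_Normal_Form_Uniqueness"
begin

hide_const (open) VectorSpace.subspace

text \<open>
  Let \<open>N\<close> be the bracket with some \<open>x\<close> outside the ideal \<open>I\<close>. The subspace
  \<open>A = {y \<in> I. J y \<in> I}\<close> is the largest \<open>J\<close>-stable subspace of \<open>I\<close>; it has codimension one in \<open>I\<close>.
  Choose \<open>e0 \<in> x + I\<close> with \<open>e1 = J e0 \<in> I\<close>, so that \<open>e0\<close>, \<open>e1\<close> and \<open>A\<close> together span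
  everything. Since brackets inside \<open>I\<close> vanish, the Nijenhuis condition on \<open>e0\<close> and \<open>A\<close> says that
  \<open>N\<close> maps \<open>A\<close> to itself and commutes there with \<open>J\<close>, and nilpotency forces \<open>N e1 \<in> A\<close>. The whole
  structure is therefore encoded by a complex linear nilpotent map on \<open>A\<close> together with one vector
  \<open>N e1\<close>; replacing \<open>e1\<close> by \<open>e1 - w\<close> with \<open>w \<in> A\<close> changes that vector by \<open>N w\<close>, so only its
  class modulo \<open>N A\<close> matters.

  Such a pair has a normal form. If the class is zero, \<open>N e1 = 0\<close> can be arranged, and a complex
  Jordan basis of \<open>A\<close> is all that is needed. Otherwise take a representative \<open>u\<close> of the class
  with the least \<open>k\<close> such that \<open>N^k u = 0\<close>. Then \<open>N^(k-1) u\<close> is not in \<open>N^k A\<close>, because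
  \<open>N^(k-1) u = N^k y\<close> would give the representative \<open>u - N y\<close> of smaller order. This is exactly the
  condition for the chain of \<open>u\<close> to split off as a direct summand (\<open>split_off_chain\<close>), so \<open>A\<close>
  has a Jordan basis whose first chain starts at \<open>N e1\<close> (\<open>jordan_basis_for_coset\<close>).

  Hence the pair is determined by the list of complex block sizes and by whether the first block is
  prolonged by \<open>e1\<close>. Over the reals every complex block occurs twice, except that \<open>e1\<close> adds a block
  of size \<open>1\<close> or lengthens one copy of the first block by one. Parity of the block counts recovers
  which case holds, the size of the prolonged block, and then all multiplicities
  (\<open>real_block_sizes_determine\<close>). The order of the chains is arbitrary, apart from a prolonged
  one coming first, which gives the asserted matrices for every admissible \<open>B\<close>. The block counts of \<open>N\<close> on \<open>I\<close>
  do not depend on \<open>J\<close>, so two complex structures on the same algebra have frames with the same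
  matrices, and the linear map that sends one frame to the other is the required automorphism
  (\<open>automorphism_of_equal_matrices\<close>).

  Complex scalars never appear explicitly: a complex basis \<open>bs\<close> is replaced by the real basis
  \<open>bs @ map J bs\<close>, and a complex linear functional by its real part.
\<close>

section \<open>Bases given by lists\<close>

definition basis_list :: "'a::real_vector set \<Rightarrow> 'a list \<Rightarrow> bool" where
  "basis_list V bs \<longleftrightarrow> distinct bs \<and> independent (set bs) \<and> span (set bs) = V"

lemma basis_list_mset:
  assumes "basis_list V bs" and "mset bs = mset cs"
  shows "basis_list V cs"
  using assms mset_eq_setD[OF assms(2)] mset_eq_imp_distinct_iff[OF assms(2)]
  by (simp add: basis_list_def)

lemma basis_list_length: "basis_list V bs \<Longrightarrow> length bs = dim V"
  unfolding basis_list_def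
  by (metis distinct_card real_vector.dim_eq_card_independent real_vector.dim_span)

text \<open>
  The bases below grow by one vector at a time. The hypotheses say that
  \<open>V\<close> is the direct sum of \<open>S\<close> and the line through \<open>a\<close>.
\<close>

lemma basis_list_Cons:
  assumes S: "basis_list S bs" and V: "subspace V" "S \<subseteq> V" and a: "a \<in> V" "a \<notin> S"
    and line: "\<And>y. y \<in> V \<Longrightarrow> \<exists>c. y - c *\<^sub>R a \<in> S"
  shows "basis_list V (a # bs)"
proof -
  have bs: "distinct bs" "independent (set bs)" "span (set bs) = S"
    using S by (auto simp: basis_list_def)
  have "a \<notin> set bs" using a bs(3) span_superset by blast
  moreover have "independent (insert a (set bs))"
    using bs a by (simp add: real_vector.independent_insertI)
  moreover have "span (insert a (set bs)) = V"
  proof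
    show "span (insert a (set bs)) \<subseteq> V"
      using a V bs(3) span_superset by (intro span_minimal) auto
    show "V \<subseteq> span (insert a (set bs))"
      unfolding span_insert bs(3) using line by blast
  qed
  ultimately show ?thesis using bs by (simp add: basis_list_def)
qed

lemma basis_list_exists:
  assumes "subspace V" "V \<subseteq> span T" "finite T"
  shows "\<exists>bs. basis_list V bs"
proof -
  obtain B where B: "B \<subseteq> V" "independent B" "V \<subseteq> span B"
    by (rule real_vector.basis_exists[of V])
  have "finite B" using real_vector.independent_span_bound[of T B] B assms by blast
  then obtain bs where "set bs = B" "distinct bs" using finite_distinct_list by blast
  moreover have "span B = V" using B assms(1) by (simp add: span_minimal subset_antisym)
  ultimately show ?thesis using B by (auto simp: basis_list_def)
qed

lemma hyperplane_complement:
  fixes I :: "'a::real_vector set"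
  assumes I: "subspace I" "dim I + 1 = dim (UNIV :: 'a set)" and x: "x \<notin> I"
    and T: "finite T" "span T = (UNIV :: 'a set)"
  shows "\<exists>c. y - c *\<^sub>R x \<in> I"
proof (rule ccontr)
  assume no: "\<not> ?thesis"
  obtain bs where bs: "basis_list I bs" using basis_list_exists[OF I(1) _ T(1)] T(2) by blast
  obtain us where us: "basis_list (UNIV :: 'a set) us"
    using basis_list_exists[OF subspace_UNIV _ T(1)] T(2) by blast
  have sp: "span (set bs) = I" and ind: "independent (set bs)" "distinct bs"
    using bs by (auto simp: basis_list_def)
  have 1: "independent (insert x (set bs))" using x sp ind by (simp add: real_vector.independent_insertI)
  have y: "y \<notin> span (insert x (set bs))" using no sp by (simp add: span_insert)
  have 2: "independent (insert y (insert x (set bs)))" using 1 y by (simp add: real_vector.independent_insertI)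
  have "y \<notin> insert x (set bs)" "x \<notin> set bs"
    using y x sp span_superset[of "insert x (set bs)"] span_superset[of "set bs"] by auto
  then have "card (insert y (insert x (set bs))) = dim I + 2"
    using ind basis_list_length[OF bs] by (simp add: distinct_card)
  moreover have "card (insert y (insert x (set bs))) \<le> card (set us)"
    using real_vector.independent_span_bound[of "set us" "insert y (insert x (set bs))"] 2 us
    by (simp add: basis_list_def)
  moreover have "card (set us) \<le> dim (UNIV :: 'a set)"
    using basis_list_length[OF us] card_length[of us] by simp
  ultimately show False using I(2) by simp
qed

section \<open>Jordan chains compatible with a complex structure\<close>

definition chain :: "('a \<Rightarrow> 'a) \<Rightarrow> 'a \<Rightarrow> nat \<Rightarrow> 'a list" where
  "chain N u k = map (\<lambda>i. (N ^^ i) u) [0..<k]"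

definition chains :: "('a \<Rightarrow> 'a) \<Rightarrow> ('a \<times> nat) list \<Rightarrow> 'a list" where
  "chains N gs = concat (map (\<lambda>(u, k). chain N u k) gs)"

lemma length_chain[simp]: "length (chain N u k) = k"
  by (simp add: chain_def)

lemma chains_simps[simp]:
  "chains N [] = []" "chains N ((u, k) # gs) = chain N u k @ chains N gs"
  "chains N (gs @ hs) = chains N gs @ chains N hs"
  by (simp_all add: chains_def)

lemma length_chains: "length (chains N gs) = sum_list (map snd gs)"
  by (induction gs) auto

lemma mset_chains: "mset gs = mset hs \<Longrightarrow> mset (chains N gs) = mset (chains N hs)"
  unfolding chains_def by (metis mset_concat mset_map sum_mset_sum_list)

definition jordan_generators :: "('a::zero \<Rightarrow> 'a) \<Rightarrow> 'a set \<Rightarrow> ('a \<times> nat) list \<Rightarrow> bool" where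
  "jordan_generators N V gs \<longleftrightarrow> (\<forall>(u, k)\<in>set gs. 0 < k \<and> u \<in> V \<and> (N ^^ k) u = 0)"

text \<open>
  In complex terms \<open>(i - c) s \<in> S\<close> with \<open>c\<close> real, and \<open>i - c\<close> is invertible; the
  computation multiplies by \<open>i + c\<close>, whose product with \<open>i - c\<close> is \<open>- 1 - c * c\<close>.
\<close>

lemma complex_line_meets_subspace:
  fixes J :: "'a::real_vector \<Rightarrow> 'a"
  assumes J: "linear J" "\<And>y. J (J y) = - y"
    and S: "subspace S" "\<And>y. y \<in> S \<Longrightarrow> J y \<in> S" and c: "J s - c *\<^sub>R s \<in> S"
  shows "s \<in> S"
proof -
  have "J (J s - c *\<^sub>R s) + c *\<^sub>R (J s - c *\<^sub>R s) \<in> S"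
    using S c by (intro subspace_add subspace_scale) auto
  also have "J (J s - c *\<^sub>R s) + c *\<^sub>R (J s - c *\<^sub>R s) = (- 1 - c * c) *\<^sub>R s"
    using J by (simp add: linear_diff linear_scale algebra_simps)
  finally have "inverse (- 1 - c * c) *\<^sub>R ((- 1 - c * c) *\<^sub>R s) \<in> S"
    using S subspace_scale by blast
  moreover have "- 1 - c * c \<noteq> 0" using zero_le_square[of c] by linarith
  ultimately show ?thesis by (simp only: scaleR_scaleR left_inverse scaleR_one) simp
qed

text \<open>
  The functional \<open>\<xi>\<close> is the real part of a complex linear functional that vanishes on \<open>S\<close> and
  takes the value \<open>1\<close> at \<open>s\<close>; the imaginary part is \<open>\<lambda>y. - \<xi> (J y)\<close>, which accounts for
  the condition at \<open>J s\<close>.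
\<close>

lemma complex_functional_exists:
  fixes S :: "'a::real_vector set"
  assumes J: "linear J" "\<And>y. J (J y) = - y"
    and S: "subspace S" "J ` S \<subseteq> S" and s: "s \<notin> S"
  obtains \<xi> :: "'a \<Rightarrow> real"
  where "linear \<xi>" "\<xi> s = 1" "\<xi> (J s) = 0" "\<forall>y\<in>S. \<xi> y = 0"
proof -
  obtain B where B: "B \<subseteq> S" "independent B" "S \<subseteq> span B"
    by (rule real_vector.basis_exists[of S])
  have sB: "span B = S" using B S by (simp add: span_minimal subset_antisym)
  have i1: "independent (insert s B)" using s B sB by (simp add: real_vector.independent_insertI)
  have Js: "J s \<notin> span (insert s B)"
  proof
    assume "J s \<in> span (insert s B)"
    then obtain c where "J s - c *\<^sub>R s \<in> S" using sB by (auto simp: span_insert)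
    then show False using complex_line_meets_subspace[OF J S(1), of s c] S(2) s by blast
  qed
  have i2: "independent (insert (J s) (insert s B))"
    using i1 Js by (simp add: real_vector.independent_insertI)
  obtain \<xi> :: "'a \<Rightarrow> real" where \<xi>: "linear \<xi>"
    "\<forall>z\<in>insert (J s) (insert s B). \<xi> z = (if z = s then 1 else 0)"
    using linear_independent_extend[OF i2, of "\<lambda>z. if z = s then 1 else 0"] by blast
  have "J s \<noteq> s" using Js span_base[of s "insert s B"] by auto
  moreover have "\<xi> y = 0" if "y \<in> S" for y
  proof (rule linear_eq_0_on_span[OF \<xi>(1), of B])
    show "\<xi> z = 0" if "z \<in> B" for z using \<xi>(2) that B(1) s by auto
    show "y \<in> span B" using that sB by simp
  qed
  ultimately show ?thesis using that \<xi> by auto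
qed

locale commuting_pair =
  fixes V :: "'a::real_vector set" and N J :: "'a \<Rightarrow> 'a"
  assumes V: "subspace V" and N: "linear N" and J: "linear J"
    and JJ: "\<And>y. J (J y) = - y"
    and NV: "\<And>y. y \<in> V \<Longrightarrow> N y \<in> V" and JV: "\<And>y. y \<in> V \<Longrightarrow> J y \<in> V"
    and NJ: "\<And>y. y \<in> V \<Longrightarrow> N (J y) = J (N y)"
begin

lemma linear_pow: "linear (N ^^ i)"
proof (induction i)
  case 0 then show ?case using linear_id by (simp add: id_def)
next
  case (Suc i) then show ?case using linear_compose[OF Suc N] by (simp add: o_def)
qed

lemma pow_V: "y \<in> V \<Longrightarrow> (N ^^ i) y \<in> V"
  by (induction i) (auto simp: NV)

lemma pow_J: "y \<in> V \<Longrightarrow> (N ^^ i) (J y) = J ((N ^^ i) y)"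
  by (induction i) (auto simp: NJ pow_V)

lemma pow_add: "(N ^^ i) ((N ^^ j) y) = (N ^^ (i + j)) y"
  by (simp add: funpow_add)

lemma pow_zero_le: "(N ^^ k) y = 0 \<Longrightarrow> k \<le> i \<Longrightarrow> (N ^^ i) y = 0"
  by (metis le_add_diff_inverse2 linear_0 linear_pow pow_add)

lemma map_J_chain: "u \<in> V \<Longrightarrow> map J (chain N u k) = chain N (J u) k"
  by (simp add: chain_def pow_J)

lemma map_J_chains:
  "jordan_generators N V gs \<Longrightarrow> map J (chains N gs) = chains N (map (\<lambda>(u, k). (J u, k)) gs)"
proof (induction gs)
  case (Cons g gs)
  obtain u k where g: "g = (u, k)" by force
  have "u \<in> V" "jordan_generators N V gs" using Cons.prems by (auto simp: g jordan_generators_def)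
  then show ?case using Cons.IH by (simp add: g map_J_chain)
qed simp

lemma jordan_generators_J:
  assumes "jordan_generators N V gs"
  shows "jordan_generators N V (map (\<lambda>(u, k). (J u, k)) gs)"
  using assms unfolding jordan_generators_def
  by (auto simp: JV pow_J linear_0[OF J])

text \<open>
  The hypothesis on \<open>s = N^(k-1) u\<close> provides a complex functional \<open>\<xi>\<close> with \<open>\<xi> s = 1\<close> that
  vanishes on \<open>N^k V\<close>. The complement of the chain is the set of \<open>y\<close> such that \<open>\<xi> (N^i y) = 0\<close>
  for all \<open>i < k\<close>; it is stable under \<open>N\<close> because \<open>\<xi> (N^k y) = 0\<close> holds for every \<open>y\<close>. Dropping the
  conditions one at a time, from \<open>i = 0\<close> upwards, gives a filtration \<open>C 0\<close>, \<open>C 1\<close>, ... up to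
  \<open>C k = V\<close>. Step \<open>j\<close> has complex dimension one and is spanned by \<open>N^(k-1-j) u\<close>, as
  \<open>N^j\<close> maps this vector to \<open>s\<close> and higher powers kill it.
\<close>

lemma split_off_chain:
  assumes u: "u \<in> V" "0 < k" "(N ^^ k) u = 0" and s: "(N ^^ (k - 1)) u \<notin> (N ^^ k) ` V"
  obtains C where "subspace C" "C \<subseteq> V" "\<And>y. y \<in> C \<Longrightarrow> N y \<in> C" "\<And>y. y \<in> C \<Longrightarrow> J y \<in> C"
    "\<And>cs. basis_list C cs \<Longrightarrow> basis_list V (chain N u k @ map J (chain N u k) @ cs)"
proof -
  have "subspace ((N ^^ k) ` V)" using linear_subspace_image[OF linear_pow V] .
  moreover have "J ` (N ^^ k) ` V \<subseteq> (N ^^ k) ` V"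
    by (auto simp: pow_J[symmetric] JV)
  ultimately obtain \<xi> :: "'a \<Rightarrow> real" where \<xi>: "linear \<xi>" "\<xi> ((N ^^ (k - 1)) u) = 1"
    "\<xi> (J ((N ^^ (k - 1)) u)) = 0" "\<forall>y\<in>(N ^^ k) ` V. \<xi> y = 0"
    by (rule complex_functional_exists[OF J JJ _ _ s])
  \<comment> \<open>The conditions on \<open>J y\<close> are those on the imaginary part of the complex functional.\<close>
  define C where "C j = {y \<in> V. \<forall>i. j \<le> i \<and> i < k \<longrightarrow> \<xi> ((N ^^ i) y) = 0 \<and> \<xi> ((N ^^ i) (J y)) = 0}" for j
  note lin = linear_add[OF \<xi>(1)] linear_scale[OF \<xi>(1)] linear_0[OF \<xi>(1)] linear_diff[OF \<xi>(1)]
    linear_neg[OF \<xi>(1)]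
    linear_add[OF linear_pow] linear_scale[OF linear_pow] linear_0[OF linear_pow]
    linear_diff[OF linear_pow] linear_neg[OF linear_pow]
    linear_add[OF J] linear_scale[OF J] linear_0[OF J] linear_diff[OF J] linear_neg[OF J]
  have subC: "subspace (C j)" for j
  proof (rule subspaceI)
    show "0 \<in> C j" by (simp add: C_def lin subspace_0[OF V])
    show "x + y \<in> C j" if "x \<in> C j" "y \<in> C j" for x y
      using that by (simp add: C_def lin subspace_add[OF V])
    show "c *\<^sub>R x \<in> C j" if "x \<in> C j" for c x
      using that by (simp add: C_def lin subspace_scale[OF V])
  qed
  have JC: "J y \<in> C j" if "y \<in> C j" for y j
    using that by (auto simp: C_def JV JJ lin)
  have NC: "N y \<in> C 0" if "y \<in> C 0" for y
  proof -
    have y: "y \<in> V" using that by (simp add: C_def)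
    have *: "\<xi> ((N ^^ Suc i) z) = 0" if "i < k" "z \<in> C 0" for i z
    proof (cases "Suc i = k")
      case True
      have "z \<in> V" using that by (simp add: C_def)
      then show ?thesis unfolding True using \<xi>(4) by blast
    next
      case False
      then have "Suc i < k" using that by simp
      then show ?thesis using that(2) unfolding C_def by blast
    qed
    have "\<xi> ((N ^^ i) (N y)) = 0 \<and> \<xi> ((N ^^ i) (J (N y))) = 0" if "i < k" for i
      using *[OF that \<open>y \<in> C 0\<close>] *[OF that JC[OF \<open>y \<in> C 0\<close>]]
      by (simp only: funpow_Suc_right o_apply NJ[OF y])
    then show ?thesis using y NV by (simp add: C_def)
  qed
  have filt: "basis_list (C j) (map (\<lambda>i. (N ^^ i) u) [k - j..<k] @ map J (map (\<lambda>i. (N ^^ i) u) [k - j..<k]) @ cs)"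
    if cs: "basis_list (C 0) cs" and "j \<le> k" for j cs
    using \<open>j \<le> k\<close>
  proof (induction j)
    case 0 then show ?case using cs by simp
  next
    case (Suc j)
    define a where "a = (N ^^ (k - Suc j)) u"
    let ?t = "map (\<lambda>i. (N ^^ i) u) [k - j..<k]"
    \<comment> \<open>Half way between \<open>C j\<close> and \<open>C (Suc j)\<close>: the real part of condition \<open>j\<close> is imposed,
      the imaginary part is not. \<open>J a\<close> spans the first half step and \<open>a\<close> the second.\<close>
    let ?S = "{y \<in> C (Suc j). \<xi> ((N ^^ j) y) = 0}"
    have aV: "a \<in> V" using u pow_V by (simp add: a_def)
    have a0: "(N ^^ i) a = 0" if "Suc j \<le> i" for i
      unfolding a_def pow_add using Suc.prems that by (intro pow_zero_le[OF u(3)]) simp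
    have aj: "(N ^^ j) a = (N ^^ (k - 1)) u"
      unfolding a_def pow_add using Suc.prems by simp
    have aC: "a \<in> C (Suc j)" using aV a0 by (auto simp: C_def pow_J lin)
    have subS: "subspace ?S" using subC[of "Suc j"] unfolding real_vector.subspace_def by (auto simp: lin)
    have CjS: "C j = {y \<in> ?S. \<xi> ((N ^^ j) (J y)) = 0}"
    proof -
      have "j \<le> i \<and> i < k \<longleftrightarrow> i = j \<or> (Suc j \<le> i \<and> i < k)" for i
        using Suc.prems by linarith
      then show ?thesis unfolding C_def by auto
    qed
    have b1: "basis_list ?S (J a # ?t @ map J ?t @ cs)"
    proof (rule basis_list_Cons[where S = "C j"])
      show "basis_list (C j) (?t @ map J ?t @ cs)" using Suc by simp
      show "J a \<in> ?S" using aC aV JC aj \<xi>(3) by (simp add: pow_J)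
      show "J a \<notin> C j" unfolding CjS using aV aj \<xi>(2) by (simp add: JJ lin)
      show "\<exists>c. y - c *\<^sub>R J a \<in> C j" if "y \<in> ?S" for y
      proof
        have "y - (- \<xi> ((N ^^ j) (J y))) *\<^sub>R J a \<in> ?S"
          using that \<open>J a \<in> ?S\<close> subS subspace_diff subspace_scale by blast
        then show "y - (- \<xi> ((N ^^ j) (J y))) *\<^sub>R J a \<in> C j"
          unfolding CjS using aj \<xi>(2) by (simp add: lin JJ)
      qed
    qed (use subS CjS in auto)
    have "basis_list (C (Suc j)) (a # J a # ?t @ map J ?t @ cs)"
    proof (rule basis_list_Cons[OF b1 subC])
      show "a \<notin> ?S" using aj \<xi>(2) by simp
      show "\<exists>c. y - c *\<^sub>R a \<in> ?S" if "y \<in> C (Suc j)" for y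
      proof
        have "y - \<xi> ((N ^^ j) y) *\<^sub>R a \<in> C (Suc j)"
          using that aC subC subspace_diff subspace_scale by blast
        then show "y - \<xi> ((N ^^ j) y) *\<^sub>R a \<in> ?S" using aj \<xi>(2) by (simp add: lin)
      qed
    qed (use aC in auto)
    moreover have "[k - Suc j..<k] = (k - Suc j) # [k - j..<k]"
      using Suc.prems by (simp add: Suc_diff_Suc upt_conv_Cons)
    ultimately show ?case
      by (elim basis_list_mset) (simp add: a_def)
  qed
  have "C k = V" by (auto simp: C_def)
  then have "basis_list V (chain N u k @ map J (chain N u k) @ cs)" if "basis_list (C 0) cs" for cs
    using filt[OF that order_refl] by (simp add: chain_def)
  moreover have "C 0 \<subseteq> V" by (auto simp: C_def)
  ultimately show thesis
    using that[of "C 0"] subC NC JC by blast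
qed

lemma restrict:
  assumes "subspace C" "C \<subseteq> V" "\<And>y. y \<in> C \<Longrightarrow> N y \<in> C" "\<And>y. y \<in> C \<Longrightarrow> J y \<in> C"
  shows "commuting_pair C N J"
  using assms N J JJ NJ by (intro commuting_pair.intro) blast+

end

text \<open>
  Induction on the dimension. If \<open>k\<close> is the nilpotency index, then \<open>N^k V = 0\<close>, so the chain of
  any \<open>u\<close> with \<open>N^(k-1) u \<noteq> 0\<close> splits off.
\<close>

lemma jordan_basis_exists:
  assumes "commuting_pair V N J" and "basis_list V bs" and "\<And>y. y \<in> V \<Longrightarrow> (N ^^ K) y = 0"
  shows "\<exists>gs. jordan_generators N V gs \<and> basis_list V (chains N gs @ map J (chains N gs))"
  using assms
proof (induction "length bs" arbitrary: V bs rule: less_induct)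
  case less
  interpret commuting_pair V N J by fact
  show ?case
  proof (cases "V = {0}")
    case True
    then have "basis_list V []" by (simp add: basis_list_def real_vector.independent_empty)
    then show ?thesis by (intro exI[of _ "[]"]) (simp add: jordan_generators_def)
  next
    case False
    define k where "k = (LEAST k. \<forall>y\<in>V. (N ^^ k) y = 0)"
    have k: "\<forall>y\<in>V. (N ^^ k) y = 0" unfolding k_def by (rule LeastI[of _ K]) (use less.prems in auto)
    have "k \<noteq> 0" using k False subspace_0[OF V] by (metis funpow_0 singletonI subset_antisym subsetI singletonD)
    then have "k - 1 < k" by simp
    then obtain u where u: "u \<in> V" "(N ^^ (k - 1)) u \<noteq> 0"
      using not_less_Least[of "k - 1" "\<lambda>k. \<forall>y\<in>V. (N ^^ k) y = 0"] unfolding k_def by blast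
    have "(N ^^ (k - 1)) u \<notin> (N ^^ k) ` V" using k u by auto
    then obtain C where C: "subspace C" "C \<subseteq> V" "\<And>y. y \<in> C \<Longrightarrow> N y \<in> C" "\<And>y. y \<in> C \<Longrightarrow> J y \<in> C"
      and ext: "\<And>cs. basis_list C cs \<Longrightarrow> basis_list V (chain N u k @ map J (chain N u k) @ cs)"
      using split_off_chain[of u k] k u \<open>k \<noteq> 0\<close> by blast
    have "V = span (set bs)" using less.prems(2) by (simp add: basis_list_def)
    then obtain cs where cs: "basis_list C cs"
      using basis_list_exists[OF C(1), of "set bs"] C(2) by auto
    have "length bs = length (chain N u k @ map J (chain N u k) @ cs)"
      using basis_list_length[OF less.prems(2)] basis_list_length[OF ext[OF cs]] by simp
    then have "length cs < length bs" using \<open>k \<noteq> 0\<close> by simp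
    then obtain gs where gs: "jordan_generators N C gs" "basis_list C (chains N gs @ map J (chains N gs))"
      using less.hyps[of cs C] cs restrict[OF C] C(2) less.prems(3) by blast
    have "jordan_generators N V ((u, k) # gs)"
      using gs(1) u k \<open>k \<noteq> 0\<close> C(2) by (auto simp: jordan_generators_def)
    moreover have "basis_list V (chains N ((u, k) # gs) @ map J (chains N ((u, k) # gs)))"
      using ext[OF gs(2)] by (elim basis_list_mset) simp
    ultimately show ?thesis by blast
  qed
qed

text \<open>
  If \<open>v\<close> is not in \<open>N V\<close>, the element \<open>u\<close> of \<open>v + N V\<close> of least nilpotency order generates a
  direct summand, and a Jordan basis of the complement completes its chain.
\<close>

lemma jordan_basis_for_coset:
  assumes "commuting_pair V N J" and bs: "basis_list V bs" and K: "\<And>y. y \<in> V \<Longrightarrow> (N ^^ K) y = 0"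
    and v: "v \<in> V"
  obtains w gs where "w \<in> V" "jordan_generators N V gs"
    "basis_list V (chains N gs @ map J (chains N gs))"
    "v = N w \<or> (gs \<noteq> [] \<and> v = fst (hd gs) + N w)"
proof (cases "v \<in> N ` V")
  case True
  then show thesis using jordan_basis_exists[OF assms(1-3)] that by blast
next
  case False
  interpret commuting_pair V N J by fact
  let ?P = "\<lambda>k. \<exists>w\<in>V. (N ^^ k) (v - N w) = 0"
  define k where "k = (LEAST k. ?P k)"
  have "?P K" using v by (intro bexI[of _ v]) (auto intro!: K subspace_diff V NV)
  then have "?P k" unfolding k_def by (rule LeastI)
  then obtain w where w: "w \<in> V" "(N ^^ k) (v - N w) = 0" by blast
  define u where "u = v - N w"
  have u: "u \<in> V" "(N ^^ k) u = 0" using w v by (auto simp: u_def intro!: subspace_diff V NV)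
  have "k \<noteq> 0" using False w by (metis eq_iff_diff_eq_0 funpow_0 imageI)
  have "(N ^^ (k - 1)) u \<notin> (N ^^ k) ` V"
  proof
    assume "(N ^^ (k - 1)) u \<in> (N ^^ k) ` V"
    then obtain y where y: "y \<in> V" "(N ^^ (k - 1)) u = (N ^^ k) y" by blast
    have "(N ^^ k) y = (N ^^ (k - 1)) (N y)"
      using \<open>k \<noteq> 0\<close> by (metis Suc_pred' bot_nat_0.not_eq_extremum comp_apply funpow_Suc_right)
    then have "(N ^^ (k - 1)) (u - N y) = 0" using y linear_diff[OF linear_pow] by simp
    moreover have "u - N y = v - N (w + y)" by (simp add: u_def linear_add[OF N])
    ultimately have "?P (k - 1)" using w y subspace_add[OF V] by metis
    then show False using not_less_Least[of "k - 1" ?P] \<open>k \<noteq> 0\<close> unfolding k_def by linarith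
  qed
  then obtain C where C: "subspace C" "C \<subseteq> V" "\<And>y. y \<in> C \<Longrightarrow> N y \<in> C" "\<And>y. y \<in> C \<Longrightarrow> J y \<in> C"
    and ext: "\<And>cs. basis_list C cs \<Longrightarrow> basis_list V (chain N u k @ map J (chain N u k) @ cs)"
    using split_off_chain[of u k] u \<open>k \<noteq> 0\<close> by blast
  have "V = span (set bs)" using bs by (simp add: basis_list_def)
  then obtain cs where cs: "basis_list C cs"
    using basis_list_exists[OF C(1), of "set bs"] C(2) by auto
  obtain gs where gs: "jordan_generators N C gs" "basis_list C (chains N gs @ map J (chains N gs))"
    using jordan_basis_exists[OF restrict[OF C] cs] C(2) K by blast
  have "jordan_generators N V ((u, k) # gs)"
    using gs(1) u \<open>k \<noteq> 0\<close> C(2) by (auto simp: jordan_generators_def)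
  moreover have "basis_list V (chains N ((u, k) # gs) @ map J (chains N ((u, k) # gs)))"
    using ext[OF gs(2)] by (elim basis_list_mset) simp
  moreover have "v = fst (hd ((u, k) # gs)) + N w" by (simp add: u_def)
  ultimately show thesis using that[of w "(u, k) # gs"] w by blast
qed

section \<open>Matrices and Jordan block counts\<close>

lemma basis_list_imp_basis_of: "basis_list V bs \<Longrightarrow> basis_of V (length bs) ((!) bs)"
proof -
  have "(!) bs ` {..<length bs} = set bs" by (auto simp: in_set_conv_nth image_iff)
  then show "basis_list V bs \<Longrightarrow> ?thesis"
    using inj_on_nth[of bs "{..<length bs}"] by (simp add: basis_list_def basis_of_def)
qed

lemma basis_of_coordinates:
  assumes "basis_of V n e" "y \<in> V"
  shows "\<exists>w. y = (\<Sum>i<n. w i *\<^sub>R e i)"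
proof -
  have "y \<in> span (e ` {..<n})" "inj_on e {..<n}" using assms by (auto simp: basis_of_def)
  then obtain u where "y = (\<Sum>v\<in>e ` {..<n}. u v *\<^sub>R v)"
    by (auto simp: real_vector.span_finite)
  then show ?thesis using \<open>inj_on e {..<n}\<close> by (auto simp: sum.reindex)
qed

lemma basis_of_coordinates_unique:
  assumes e: "basis_of V n e" and eq: "(\<Sum>i<n. w i *\<^sub>R e i) = (\<Sum>i<n. w' i *\<^sub>R e i)" and "i < n"
  shows "w i = w' i"
proof -
  have inj: "inj_on e {..<n}" and ind: "independent (e ` {..<n})" using e by (auto simp: basis_of_def)
  define g where "g v = (let i = the_inv_into {..<n} e v in w i - w' i)" for v
  have ge: "g (e i) = w i - w' i" if "i < n" for i
    using the_inv_into_f_f[OF inj] that by (simp add: g_def Let_def)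
  have "(\<Sum>v\<in>e ` {..<n}. g v *\<^sub>R v) = (\<Sum>i<n. (w i - w' i) *\<^sub>R e i)"
    using inj by (simp add: sum.reindex ge)
  also have "\<dots> = 0" using eq by (simp add: scaleR_left_diff_distrib sum_subtractf)
  finally have "g (e i) = 0"
    using ind \<open>i < n\<close> unfolding real_vector.independent_explicit_finite_subsets[of "e ` {..<n}"]
    by blast
  then show ?thesis using ge \<open>i < n\<close> by simp
qed

lemma sum_mat_apply:
  fixes e :: "nat \<Rightarrow> 'a::real_vector"
  shows "(\<Sum>i<n. a i *\<^sub>R (\<Sum>l<n. X $$ (l, i) *\<^sub>R e l)) = (\<Sum>l<n. (\<Sum>i<n. X $$ (l, i) * a i) *\<^sub>R e l)"
proof -
  have "(\<Sum>i<n. a i *\<^sub>R (\<Sum>l<n. X $$ (l, i) *\<^sub>R e l)) = (\<Sum>i<n. \<Sum>l<n. (X $$ (l, i) * a i) *\<^sub>R e l)"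
    by (simp add: scaleR_sum_right mult.commute)
  also have "\<dots> = (\<Sum>l<n. \<Sum>i<n. (X $$ (l, i) * a i) *\<^sub>R e l)" by (rule sum.swap)
  finally show ?thesis by (simp add: scaleR_sum_left)
qed

lemma index_mult_mat_sum:
  "A \<in> carrier_mat n n \<Longrightarrow> B \<in> carrier_mat n n \<Longrightarrow> i < n \<Longrightarrow> k < n \<Longrightarrow>
    (A * B) $$ (i, k) = (\<Sum>j<n. A $$ (i, j) * B $$ (j, k))"
  by (simp add: scalar_prod_def atLeast0LessThan)

lemma represented_by_similar:
  assumes f: "linear f"
    and e: "basis_of V n e" "represented_by n e f M"
    and e': "basis_of V n e'" "represented_by n e' f M'"
  shows "similar_mat M M'"
proof -
  have sup: "e k \<in> V" "e' k \<in> V" if "k < n" for k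
    using that e(1) e'(1) span_base[of "e k" "e ` {..<n}"] span_base[of "e' k" "e' ` {..<n}"]
    by (auto simp: basis_of_def)
  obtain p where p: "\<And>k. k < n \<Longrightarrow> e' k = (\<Sum>i<n. p k i *\<^sub>R e i)"
    using basis_of_coordinates[OF e(1) sup(2)] by metis
  obtain q where q: "\<And>k. k < n \<Longrightarrow> e k = (\<Sum>i<n. q k i *\<^sub>R e' i)"
    using basis_of_coordinates[OF e'(1) sup(1)] by metis
  define P where "P = mat n n (\<lambda>(i, k). p k i)"
  define Q where "Q = mat n n (\<lambda>(i, k). q k i)"
  have P: "e' k = (\<Sum>i<n. P $$ (i, k) *\<^sub>R e i)" if "k < n" for k using p that by (simp add: P_def)
  have Q: "e k = (\<Sum>i<n. Q $$ (i, k) *\<^sub>R e' i)" if "k < n" for k using q that by (simp add: Q_def)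
  have M: "M \<in> carrier_mat n n" "f (e k) = (\<Sum>i<n. M $$ (i, k) *\<^sub>R e i)" if "k < n" for k
    using e(2) that by (auto simp: represented_by_def)
  have M': "M' \<in> carrier_mat n n" "f (e' k) = (\<Sum>i<n. M' $$ (i, k) *\<^sub>R e' i)" if "k < n" for k
    using e'(2) that by (auto simp: represented_by_def)
  have C: "M \<in> carrier_mat n n" "M' \<in> carrier_mat n n" "P \<in> carrier_mat n n" "Q \<in> carrier_mat n n"
    using e(2) e'(2) by (auto simp: represented_by_def P_def Q_def)
  have inv: "X * Y = 1\<^sub>m n"
    if b: "basis_of V n b" and X: "X \<in> carrier_mat n n" and Y: "Y \<in> carrier_mat n n"
      and bX: "\<And>k. k < n \<Longrightarrow> b' k = (\<Sum>i<n. X $$ (i, k) *\<^sub>R b i)"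
      and bY: "\<And>k. k < n \<Longrightarrow> b k = (\<Sum>i<n. Y $$ (i, k) *\<^sub>R b' i)" for b b' X Y
  proof (rule eq_matI)
    fix l k assume "l < dim_row (1\<^sub>m n :: real mat)" "k < dim_col (1\<^sub>m n :: real mat)"
    then have lk: "l < n" "k < n" by auto
    have "(\<Sum>l<n. (\<Sum>i<n. X $$ (l, i) * Y $$ (i, k)) *\<^sub>R b l) = (\<Sum>i<n. Y $$ (i, k) *\<^sub>R (\<Sum>l<n. X $$ (l, i) *\<^sub>R b l))"
      by (simp only: sum_mat_apply)
    also have "\<dots> = b k" unfolding bY[OF lk(2)] by (rule sum.cong) (simp_all add: bX)
    also have "\<dots> = (\<Sum>l<n. (if l = k then 1 else 0) *\<^sub>R b l)" using lk by (simp add: if_distrib[of "\<lambda>c. c *\<^sub>R _"] cong: if_cong)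
    finally have "(\<Sum>i<n. X $$ (l, i) * Y $$ (i, k)) = (if l = k then 1 else 0)"
      by (rule basis_of_coordinates_unique[OF b _ lk(1)])
    then show "(X * Y) $$ (l, k) = 1\<^sub>m n $$ (l, k)"
      using X Y lk by (simp add: index_mult_mat_sum del: index_mult_mat)
  qed (use X Y in auto)
  have PQ: "P * Q = 1\<^sub>m n" by (rule inv[OF e(1) C(3,4) P Q])
  have QP: "Q * P = 1\<^sub>m n" by (rule inv[OF e'(1) C(4,3) Q P])
  have "M * P = P * M'"
  proof (rule eq_matI)
    fix l k assume "l < dim_row (P * M')" "k < dim_col (P * M')"
    then have lk: "l < n" "k < n" using C by auto
    have "(\<Sum>l<n. (\<Sum>i<n. M $$ (l, i) * P $$ (i, k)) *\<^sub>R e l) = (\<Sum>i<n. P $$ (i, k) *\<^sub>R f (e i))"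
      by (simp only: sum_mat_apply[symmetric]) (simp add: M(2))
    also have "\<dots> = f (e' k)"
      unfolding P[OF lk(2)] by (simp add: linear_sum[OF f] linear_scale[OF f])
    also have "\<dots> = (\<Sum>i<n. M' $$ (i, k) *\<^sub>R (\<Sum>l<n. P $$ (l, i) *\<^sub>R e l))"
      unfolding M'(2)[OF lk(2)] by (rule sum.cong) (simp_all add: P)
    also have "\<dots> = (\<Sum>l<n. (\<Sum>i<n. P $$ (l, i) * M' $$ (i, k)) *\<^sub>R e l)"
      by (rule sum_mat_apply)
    finally have "(\<Sum>i<n. M $$ (l, i) * P $$ (i, k)) = (\<Sum>i<n. P $$ (l, i) * M' $$ (i, k))"
      by (rule basis_of_coordinates_unique[OF e(1) _ lk(1)])
    then show "(M * P) $$ (l, k) = (P * M') $$ (l, k)"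
      using C lk by (simp add: index_mult_mat_sum del: index_mult_mat)
  qed (use C in auto)
  then have "P * M' * Q = M * (P * Q)" using C by (metis assoc_mult_mat)
  also have "\<dots> = M" using PQ C by simp
  finally have "similar_mat_wit M M' P Q"
    using C PQ QP by (simp add: similar_mat_wit_def Let_def)
  then show ?thesis unfolding similar_mat_def by blast
qed

text \<open>
  The number of blocks of each positive size for each eigenvalue is a function of the matrix, and
  blocks of size \<open>0\<close> are excluded by definition.
\<close>

lemma jordan_nf_mset_unique:
  fixes A :: "'a::field mat"
  assumes "jordan_nf A n_as" "jordan_nf A m_bs"
  shows "mset n_as = mset m_bs"
proof (rule multiset_eqI)
  fix x :: "nat \<times> 'a"
  obtain k a where x: "x = (k, a)" by force
  show "count (mset n_as) x = count (mset m_bs) x"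
  proof (cases "k = 0")
    case True
    then show ?thesis using assms unfolding jordan_nf_def x
      by (metis count_mset_0_iff fst_conv image_eqI)
  next
    case False
    then show ?thesis
      using compute_nr_of_jordan_blocks[OF assms(1) False, of a]
        compute_nr_of_jordan_blocks[OF assms(2) False, of a]
      by (simp add: x count_mset count_list_eq_length_filter)
  qed
qed

lemma jordan_block_counts_unique:
  assumes f: "linear f" and m: "jordan_block_counts V f m" and m': "jordan_block_counts V f m'"
  shows "m = m'"
proof -
  obtain e M n_as where 1: "basis_of V (dim V) e" "represented_by (dim V) e f M" "jordan_nf M n_as"
    "\<forall>i. m i = count_list (map fst n_as) i" using m unfolding jordan_block_counts_def by blast
  obtain e' M' m_bs where 2: "basis_of V (dim V) e'" "represented_by (dim V) e' f M'" "jordan_nf M' m_bs"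
    "\<forall>i. m' i = count_list (map fst m_bs) i" using m' unfolding jordan_block_counts_def by blast
  have "similar_mat M' M" by (rule represented_by_similar[OF f 2(1,2) 1(1,2)])
  then have "jordan_nf M' n_as"
    using 1(3) similar_mat_trans unfolding jordan_nf_def by blast
  then have "mset n_as = mset m_bs" using 2(3) jordan_nf_mset_unique by blast
  then have "mset (map fst n_as) = mset (map fst m_bs)" by simp
  then show ?thesis using 1(4) 2(4) by (metis count_mset ext)
qed

lemma sum_lessThan_append:
  "(\<Sum>i<length as + length bs. c i *\<^sub>R (as @ bs) ! i) =
    (\<Sum>i<length as. c i *\<^sub>R as ! i) + (\<Sum>i<length bs. c (length as + i) *\<^sub>R (bs ! i :: 'a::real_vector))"
  by (simp add: lessThan_atLeast0 sum.atLeastLessThan_concat[symmetric, of 0 "length as" "length as + length bs"]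
      sum.shift_bounds_nat_ivl sum.atLeastLessThan_shift_0[of _ "length as" "length as + length bs"] nth_append add.commute)

lemma represented_by_four_block:
  assumes "A \<in> carrier_mat (length as) (length as)" "D \<in> carrier_mat (length bs) (length bs)"
    and "\<And>k. k < length as \<Longrightarrow>
      f (as ! k) = (\<Sum>i<length as. A $$ (i, k) *\<^sub>R as ! i) + (\<Sum>i<length bs. C $$ (i, k) *\<^sub>R bs ! i)"
    and "\<And>k. k < length bs \<Longrightarrow>
      f (bs ! k) = (\<Sum>i<length as. B $$ (i, k) *\<^sub>R as ! i) + (\<Sum>i<length bs. D $$ (i, k) *\<^sub>R bs ! i)"
  shows "represented_by (length as + length bs) ((!) (as @ bs)) f (four_block_mat A B C D)"
  unfolding represented_by_def
proof (intro conjI allI impI)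
  show "four_block_mat A B C D \<in> carrier_mat (length as + length bs) (length as + length bs)"
    using assms by simp
  fix k assume k: "k < length as + length bs"
  have d: "dim_row A = length as" "dim_col A = length as" "dim_row D = length bs" "dim_col D = length bs"
    using assms by auto
  show "f ((as @ bs) ! k) = (\<Sum>i<length as + length bs. four_block_mat A B C D $$ (i, k) *\<^sub>R (as @ bs) ! i)"
    unfolding sum_lessThan_append
    using k assms(3)[of k] assms(4)[of "k - length as"] by (simp add: d nth_append)
qed

lemma represented_by_block_diag:
  assumes "represented_by (length as) ((!) as) f A" "represented_by (length bs) ((!) bs) f D"
  shows "represented_by (length as + length bs) ((!) (as @ bs)) f
    (four_block_mat A (0\<^sub>m (length as) (length bs)) (0\<^sub>m (length bs) (length as)) D)"
  using assms by (intro represented_by_four_block) (auto simp: represented_by_def)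

lemma represented_by_chain:
  assumes "(N ^^ k) u = 0"
  shows "represented_by k ((!) (chain N u k)) N (transpose_mat (jordan_block k 0))"
  unfolding represented_by_def
proof (intro conjI allI impI)
  fix l assume l: "l < k"
  have "(\<Sum>i<k. transpose_mat (jordan_block k 0) $$ (i, l) *\<^sub>R chain N u k ! i) =
      (\<Sum>i<k. if i = Suc l then (N ^^ i) u else 0)"
  proof (rule sum.cong)
    fix i assume "i \<in> {..<k}"
    then show "transpose_mat (jordan_block k 0) $$ (i, l) *\<^sub>R chain N u k ! i =
        (if i = Suc l then (N ^^ i) u else 0)"
      using l by (simp add: chain_def del: funpow.simps)
  qed simp
  also have "\<dots> = (N ^^ Suc l) u"
  proof (cases "Suc l < k")
    case True then show ?thesis by (simp add: sum.delta)
  next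
    case False
    then have "Suc l = k" using l by simp
    then show ?thesis using assms by (simp add: sum.delta del: funpow.simps)
  qed
  finally show "N (chain N u k ! l) = (\<Sum>i<k. transpose_mat (jordan_block k 0) $$ (i, l) *\<^sub>R chain N u k ! i)"
    using l by (simp add: chain_def)
qed simp

text \<open>
  A chain \<open>u, N u, ...\<close> has the ones of its matrix below the diagonal; reading it backwards
  gives a block in the convention of \<^const>\<open>jordan_block\<close>, which block counts refer to.
\<close>

lemma represented_by_rev_chain:
  assumes "(N ^^ k) u = 0"
  shows "represented_by k ((!) (rev (chain N u k))) N (jordan_block k 0)"
  unfolding represented_by_def
proof (intro conjI allI impI)
  fix l assume l: "l < k"
  have rc: "rev (chain N u k) ! i = (N ^^ (k - Suc i)) u" if "i < k" for i
    using that by (simp add: chain_def rev_nth)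
  have "(\<Sum>i<k. jordan_block k 0 $$ (i, l) *\<^sub>R rev (chain N u k) ! i) =
      (\<Sum>i<k. if Suc i = l then (N ^^ (k - Suc i)) u else 0)"
  proof (rule sum.cong)
    fix i assume "i \<in> {..<k}"
    then show "jordan_block k 0 $$ (i, l) *\<^sub>R rev (chain N u k) ! i =
        (if Suc i = l then (N ^^ (k - Suc i)) u else 0)"
      using l by (simp add: rc del: funpow.simps)
  qed simp
  also have "\<dots> = (N ^^ (k - l)) u"
  proof (cases l)
    case 0 then show ?thesis using assms by simp
  next
    case (Suc l')
    then show ?thesis using l by (simp add: sum.delta)
  qed
  also have "\<dots> = N (rev (chain N u k) ! l)"
    using l by (simp add: rc) (metis Suc_diff_Suc comp_apply funpow.simps(2))
  finally show "N (rev (chain N u k) ! l) = (\<Sum>i<k. jordan_block k 0 $$ (i, l) *\<^sub>R rev (chain N u k) ! i)" ..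
qed simp

lemma map_fst_Pair: "map fst (map (\<lambda>k. (k, a)) ns) = ns"
  by (induction ns) auto

lemma nilpotent_lower_jordan_Cons:
  "map_mat real_of_int (nilpotent_lower_jordan (k # ns)) =
    four_block_mat (transpose_mat (jordan_block k 0)) (0\<^sub>m k (sum_list ns)) (0\<^sub>m (sum_list ns) k)
      (map_mat real_of_int (nilpotent_lower_jordan ns))"
proof -
  have J: "jordan_matrix (map (\<lambda>k. (k, 0::int)) ns) \<in> carrier_mat (sum_list ns) (sum_list ns)"
    using jordan_matrix_carrier[of "map (\<lambda>k. (k, 0::int)) ns"] by (simp only: map_fst_Pair)
  have "map_mat real_of_int (transpose_mat (jordan_block k 0)) = transpose_mat (jordan_block k 0)"
    "map_mat real_of_int (0\<^sub>m k (sum_list ns)) = 0\<^sub>m k (sum_list ns)"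
    "map_mat real_of_int (0\<^sub>m (sum_list ns) k) = 0\<^sub>m (sum_list ns) k"
    by (rule eq_matI; auto)+
  then show ?thesis
    unfolding nilpotent_lower_jordan_def list.map jordan_matrix_Cons map_fst_Pair
    using J by (simp add: transpose_four_block_mat[OF jordan_block_carrier zero_carrier_mat zero_carrier_mat J]
      map_four_block_mat[of _ k k _ "sum_list ns" _ "sum_list ns"])
qed

lemma nilpotent_lower_jordan_carrier:
  "nilpotent_lower_jordan ns \<in> carrier_mat (sum_list ns) (sum_list ns)"
  using jordan_matrix_carrier[of "map (\<lambda>k. (k, 0::int)) ns"]
  unfolding nilpotent_lower_jordan_def map_fst_Pair by simp

lemma represented_by_chains:
  assumes "jordan_generators N V gs"
  shows "represented_by (length (chains N gs)) ((!) (chains N gs)) N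
    (map_mat real_of_int (nilpotent_lower_jordan (map snd gs)))"
  using assms
proof (induction gs)
  case Nil
  then show ?case using nilpotent_lower_jordan_carrier[of "[]"] by (simp add: represented_by_def)
next
  case (Cons g gs)
  obtain u k where g: "g = (u, k)" by force
  have "(N ^^ k) u = 0" "jordan_generators N V gs"
    using Cons.prems by (auto simp: g jordan_generators_def)
  then show ?case
    using represented_by_block_diag[of "chain N u k" N _ "chains N gs"] represented_by_chain[OF \<open>(N ^^ k) u = 0\<close>] Cons.IH
    by (simp add: g nilpotent_lower_jordan_Cons length_chains)
qed

lemma jordan_block_counts_chains:
  assumes "jordan_generators N V gs" and "basis_list V (chains N gs)"
  shows "jordan_block_counts V N (count_list (map snd gs))"
proof -
  define rchains where "rchains gs = concat (map (\<lambda>(u, k). rev (chain N u k)) gs)" for gs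
  have len: "length (rchains gs) = sum_list (map snd gs)" for gs
    by (induction gs) (auto simp: rchains_def split: prod.split)
  let ?n_as = "\<lambda>gs. map (\<lambda>k. (k, 0)) (map snd gs) :: (nat \<times> real) list"
  have rep: "represented_by (length (rchains gs)) ((!) (rchains gs)) N (jordan_matrix (?n_as gs))"
    using assms(1)
  proof (induction gs)
    case Nil
    then show ?case using jordan_matrix_carrier[of "[] :: (nat \<times> real) list"]
      by (simp add: represented_by_def rchains_def)
  next
    case (Cons g gs)
    obtain u k where g: "g = (u, k)" by force
    have u: "(N ^^ k) u = 0" and "jordan_generators N V gs"
      using Cons.prems by (auto simp: g jordan_generators_def)
    moreover have "rchains (g # gs) = rev (chain N u k) @ rchains gs" by (simp add: rchains_def g)
    ultimately show ?case
      using represented_by_block_diag[of "rev (chain N u k)" N _ "rchains gs"]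
        represented_by_rev_chain[OF u] Cons.IH len[of gs]
      by (simp only: g list.map jordan_matrix_Cons map_fst_Pair snd_conv length_append length_rev length_chain)
  qed
  have "mset (chains N gs) = mset (rchains gs)"
    by (induction gs) (auto simp: rchains_def)
  then have b: "basis_list V (rchains gs)" using assms(2) basis_list_mset by blast
  then have "basis_of V (dim V) ((!) (rchains gs))" "length (rchains gs) = dim V"
    using basis_list_imp_basis_of basis_list_length by metis+
  moreover have "jordan_nf (jordan_matrix (?n_as gs)) (?n_as gs)"
    using assms(1) unfolding jordan_nf_def jordan_generators_def
    by (force intro!: similar_mat_refl[OF jordan_matrix_carrier])
  moreover have "\<forall>i. count_list (map snd gs) i = count_list (map fst (?n_as gs)) i"
    unfolding map_fst_Pair by simp
  ultimately show ?thesis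
    using rep unfolding jordan_block_counts_def by metis
qed

section \<open>Real block sizes\<close>

text \<open>
  The block sizes of \<open>N\<close> on \<open>I\<close> when \<open>ns\<close> are the complex block sizes on the complex part of
  \<open>I\<close>. The flag \<open>b\<close> tells whether the remaining basis vector prolongs one of the two real copies
  of the first block or forms a block of its own.
\<close>

definition real_block_sizes :: "bool \<Rightarrow> nat list \<Rightarrow> nat list" where
  "real_block_sizes b ns = (if b then Suc (hd ns) # tl ns @ ns else 1 # ns @ ns)"

lemma count_real_block_sizes:
  assumes "b \<longrightarrow> ns \<noteq> []"
  shows "count_list (real_block_sizes b ns) i + (if b \<and> i = hd ns then 1 else 0) =
    2 * count_list ns i + (if i = (if b then Suc (hd ns) else 1) then 1 else 0)"
  using assms by (cases ns) (auto simp: real_block_sizes_def)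

lemma odd_count_real_block_sizes:
  assumes "b \<longrightarrow> ns \<noteq> []"
  shows "odd (count_list (real_block_sizes b ns) i) \<longleftrightarrow> (if b then i = hd ns \<or> i = Suc (hd ns) else i = 1)"
  using count_real_block_sizes[OF assms, of i] by (auto split: if_splits) presburger+

text \<open>
  The sizes that occur an odd number of times are \<open>k\<close> and \<open>k + 1\<close> when a block of size \<open>k > 0\<close> is
  prolonged, and only \<open>1\<close> otherwise. These sets are all different; once the case is known, the
  other multiplicities are halved.
\<close>

lemma real_block_sizes_determine:
  assumes eq: "count_list (real_block_sizes b ns) = count_list (real_block_sizes b' ns')"
    and ns: "b \<longrightarrow> ns \<noteq> []" "0 \<notin> set ns" and ns': "b' \<longrightarrow> ns' \<noteq> []" "0 \<notin> set ns'"
  shows "b = b'" "b \<Longrightarrow> hd ns = hd ns'" "mset ns = mset ns'"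
proof -
  have odd: "(if b then i = hd ns \<or> i = Suc (hd ns) else i = 1) \<longleftrightarrow>
      (if b' then i = hd ns' \<or> i = Suc (hd ns') else i = 1)" for i
    using odd_count_real_block_sizes[OF ns(1), of i] odd_count_real_block_sizes[OF ns'(1), of i] eq
    by simp
  have pos: "b \<Longrightarrow> hd ns \<noteq> 0" "b' \<Longrightarrow> hd ns' \<noteq> 0"
    using ns ns' hd_in_set[of ns] hd_in_set[of ns'] by metis+
  show b: "b = b'"
    using odd[of "Suc (hd ns)"] odd[of "Suc (hd ns')"] pos by (auto split: if_splits)
  show hd: "hd ns = hd ns'" if b
  proof -
    have "hd ns = hd ns' \<or> hd ns = Suc (hd ns')" using odd[of "hd ns"] that b by simp
    moreover have "hd ns' = hd ns \<or> hd ns' = Suc (hd ns)" using odd[of "hd ns'"] that b by simp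
    ultimately show ?thesis by linarith
  qed
  have "count_list ns i = count_list ns' i" for i
    using count_real_block_sizes[OF ns(1), of i] count_real_block_sizes[OF ns'(1), of i] eq b hd
    by (auto split: if_splits)
  then show "mset ns = mset ns'" by (intro multiset_eqI) (simp add: count_mset)
qed

text \<open>
  The overlapping block of the partition is the first block of \<open>ns\<close> prolonged by one.
\<close>

lemma associated_partition_real_block_sizes:
  assumes "associated_partition m n q j"
    and ns: "0 \<notin> set ns" "\<forall>i>0. count_list ns i = q i" "j > 1 \<longrightarrow> ns \<noteq> [] \<and> hd ns = j - 1"
    and "i > 0"
  shows "m i = count_list (real_block_sizes (j > 1) ns) i"
proof -
  have c: "count_list (real_block_sizes (j > 1) ns) i + (if j > 1 \<and> i = hd ns then 1 else 0) =
    2 * q i + (if i = (if j > 1 then Suc (hd ns) else 1) then 1 else 0)"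
    using count_real_block_sizes[of "j > 1" ns i] ns \<open>i > 0\<close> by simp
  from assms(1) have "(j = 1 \<and> m 1 = 2 * q 1 + 1 \<and> (\<forall>i>1. m i = 2 * q i)) \<or>
      (j > 1 \<and> q (j - 1) > 0 \<and> m j = 2 * q j + 1 \<and> m (j - 1) = 2 * q (j - 1) - 1 \<and>
        (\<forall>i>0. i \<noteq> j \<and> i \<noteq> j - 1 \<longrightarrow> m i = 2 * q i))"
    unfolding associated_partition_def by (rule conjunct2)
  then show ?thesis
  proof (elim disjE conjE)
    assume "j = 1" "m 1 = 2 * q 1 + 1" "\<forall>i>1. m i = 2 * q i"
    then show ?thesis using c \<open>i > 0\<close> by (cases "i = 1") auto
  next
    assume j: "j > 1" "q (j - 1) > 0" "m j = 2 * q j + 1" "m (j - 1) = 2 * q (j - 1) - 1"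
      and m: "\<forall>i>0. i \<noteq> j \<and> i \<noteq> j - 1 \<longrightarrow> m i = 2 * q i"
    have h: "hd ns = j - 1" "Suc (hd ns) = j" using ns j(1) by auto
    consider "i = j" | "i = j - 1" | "i \<noteq> j" "i \<noteq> j - 1" by blast
    then show ?thesis
    proof cases
      case 1
      moreover have "i \<noteq> hd ns" using 1 h j(1) by linarith
      ultimately show ?thesis using c j h by simp
    next
      case 2
      then have "i \<noteq> Suc (hd ns)" using h(1) by linarith
      then have "count_list (real_block_sizes (j > 1) ns) i + 1 = 2 * q i"
        using c j(1) 2 h(1) by simp
      moreover have "m i = 2 * q i - 1" using 2 j(4) by simp
      ultimately show ?thesis by linarith
    next
      case 3 then show ?thesis using c j h m \<open>i > 0\<close> by simp
    qed
  qed
qed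

text \<open>
  A rearrangement of the sizes comes from a rearrangement of the chains.
\<close>

lemma mset_map_eq_lift:
  "mset ys = mset (map f xs) \<Longrightarrow> \<exists>xs'. mset xs' = mset xs \<and> map f xs' = ys"
proof (induction ys arbitrary: xs)
  case (Cons y ys)
  have "y \<in># mset (map f xs)" using Cons.prems by (metis list.set_intros(1) set_mset_mset)
  then obtain x where x: "x \<in> set xs" "f x = y" by auto
  have "mset (map f xs) = add_mset y (mset (map f (remove1 x xs)))"
  proof -
    have "mset xs = add_mset x (mset (remove1 x xs))" using x by simp
    then show ?thesis using x(2) by (metis image_mset_add_mset mset_map)
  qed
  then have "mset ys = mset (map f (remove1 x xs))" using Cons.prems by simp
  then obtain xs' where "mset xs' = mset (remove1 x xs)" "map f xs' = ys" using Cons.IH by blast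
  then show ?case using x by (intro exI[of _ "x # xs'"]) simp
qed simp

section \<open>Complex structures on nilpotent almost abelian Lie algebras\<close>

locale complex_almost_abelian =
  fixes br :: "'a::real_vector \<Rightarrow> 'a \<Rightarrow> 'a" and I :: "'a set" and J :: "'a \<Rightarrow> 'a" and x :: 'a
  assumes lie: "real_lie_algebra br"
    and finite_dim: "\<exists>S::'a set. finite S \<and> span S = UNIV"
    and nilpotent: "nilpotent_lie br"
    and ideal: "codim_one_abelian_ideal br I"
    and complex: "complex_structure br J"
    and outside: "x \<notin> I"
begin

lemma bilinear_br: "bilinear br" using lie by (simp add: real_lie_algebra_def)

lemma linear_br: "linear (br y)" using bilinear_br by (simp add: bilinear_def)

lemma subspace_I: "subspace I" using ideal by (simp add: codim_one_abelian_ideal_def lie_ideal_def)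

lemma br_I: "y \<in> I \<Longrightarrow> br z y \<in> I"
  using ideal by (simp add: codim_one_abelian_ideal_def lie_ideal_def)

lemma abelian_I: "y \<in> I \<Longrightarrow> z \<in> I \<Longrightarrow> br y z = 0"
  using ideal by (simp add: codim_one_abelian_ideal_def abelian_on_def)

lemma linear_J: "linear J" and J_J: "J (J y) = - y" and nijenhuis_0: "nijenhuis br J y z = 0"
  using complex by (auto simp: complex_structure_def)

lemma line_complement: "z \<notin> I \<Longrightarrow> \<exists>c. y - c *\<^sub>R z \<in> I"
proof -
  obtain T where T: "finite T" "span T = (UNIV :: 'a set)" using finite_dim by blast
  show "z \<notin> I \<Longrightarrow> ?thesis"
    using hyperplane_complement[OF subspace_I _ _ T] ideal
    by (simp add: codim_one_abelian_ideal_def)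
qed

lemma funpow_br_nilpotent: "\<exists>K. \<forall>y. (br z ^^ K) y = 0"
proof -
  obtain K where K: "lower_central br K = {0}" using nilpotent unfolding nilpotent_lie_def by blast
  have "(br z ^^ k) y \<in> lower_central br k" for k y
  proof (induction k)
    case (Suc k)
    then show ?case by (auto intro!: span_base)
  qed simp
  then show ?thesis using K by blast
qed

text \<open>
  \<open>I\<close> is not \<open>J\<close>-stable, since a \<open>J\<close>-stable subspace has even codimension. If \<open>y \<in> I\<close> and
  \<open>J y\<close> is outside \<open>I\<close>, then a multiple of \<open>J y\<close> lies in \<open>x + I\<close>, and \<open>J\<close> maps it back
  into the line through \<open>y\<close>. Staying in the coset of \<open>x\<close> keeps the bracket on \<open>I\<close> the same for
  all complex structures.
\<close>

lemma transversal_exists: "\<exists>e0. e0 - x \<in> I \<and> J e0 \<in> I"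
proof -
  have "\<exists>y\<in>I. J y \<notin> I"
  proof (rule ccontr)
    assume no: "\<not> ?thesis"
    obtain c where "J x - c *\<^sub>R x \<in> I" using line_complement[OF outside] by blast
    then show False
      using complex_line_meets_subspace[OF linear_J J_J subspace_I, of x c] no outside by blast
  qed
  then obtain y where y: "y \<in> I" "J y \<notin> I" by blast
  obtain c where c: "J y - c *\<^sub>R x \<in> I" using line_complement[OF outside] by blast
  have "c \<noteq> 0" using c y by auto
  have "inverse c *\<^sub>R (J y - c *\<^sub>R x) \<in> I" using c subspace_I subspace_scale by blast
  then have "inverse c *\<^sub>R J y - x \<in> I" using \<open>c \<noteq> 0\<close> by (simp add: scaleR_diff_right)
  moreover have "J (inverse c *\<^sub>R J y) \<in> I"
    using y subspace_I by (simp add: linear_scale[OF linear_J] J_J subspace_neg subspace_scale)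
  ultimately show ?thesis by blast
qed

lemma transversal_outside: "e0 - x \<in> I \<Longrightarrow> e0 \<notin> I"
  using outside subspace_diff[OF subspace_I, of e0 "e0 - x"] by auto

lemma br_transversal:
  assumes "e0 - x \<in> I" "y \<in> I"
  shows "br e0 y = br x y"
  using abelian_I[OF assms] bilinear_lsub[OF bilinear_br, of e0 x y] by simp

definition complex_core :: "'a set" where "complex_core = {y \<in> I. J y \<in> I}"

lemma subspace_complex_core: "subspace complex_core"
  using subspace_I unfolding complex_core_def
  by (intro subspaceI) (auto simp: linear_0[OF linear_J] linear_add[OF linear_J] linear_scale[OF linear_J]
      subspace_0 subspace_add subspace_scale)

text \<open>
  In the Nijenhuis tensor of \<open>e0\<close> and \<open>y\<close> the two brackets with \<open>J e0\<close> vanish, as both arguments lie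
  in the abelian ideal. What remains says that \<open>J\<close> commutes with the bracket by \<open>e0\<close>.
\<close>

lemma commuting_pair_complex_core: "commuting_pair complex_core (br x) J"
proof -
  obtain e0 where e0: "e0 - x \<in> I" "J e0 \<in> I" using transversal_exists by blast
  have NJ: "br x (J y) = J (br x y)" if "y \<in> complex_core" for y
  proof -
    have y: "y \<in> I" "J y \<in> I" using that by (auto simp: complex_core_def)
    have "br (J e0) (J y) = 0" "br (J e0) y = 0" using y e0 abelian_I by auto
    then have "J (br x (J y)) = - br x y"
      using nijenhuis_0[of e0 y] br_transversal[OF e0(1)] y
      by (simp add: nijenhuis_def linear_0[OF linear_J] eq_neg_iff_add_eq_0 neg_eq_iff_add_eq_0)
    then have "J (J (br x (J y))) = - J (br x y)" by (simp add: linear_neg[OF linear_J])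
    then show ?thesis by (simp add: J_J)
  qed
  show ?thesis
  proof
    show "br x y \<in> complex_core" if "y \<in> complex_core" for y
    proof -
      have "J (br x y) \<in> I" using NJ[OF that, symmetric] that br_I by (simp add: complex_core_def)
      then show ?thesis using that br_I by (simp add: complex_core_def)
    qed
    show "J y \<in> complex_core" if "y \<in> complex_core" for y
      using that subspace_neg[OF subspace_I] by (simp add: complex_core_def J_J)
  qed (use subspace_complex_core linear_br linear_J NJ J_J in \<open>auto simp: linear_add linear_scale\<close>)
qed

lemma complex_core_complement:
  assumes e0: "e0 - x \<in> I" "J e0 \<in> I"
  shows "J e0 \<in> I" "J e0 \<notin> complex_core" "y \<in> I \<Longrightarrow> \<exists>c. y - c *\<^sub>R J e0 \<in> complex_core"
proof -
  show "J e0 \<in> I" by fact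
  show "J e0 \<notin> complex_core"
    using transversal_outside[OF e0(1)] subspace_neg[OF subspace_I, of "- e0"] by (auto simp: complex_core_def J_J)
  show "\<exists>c. y - c *\<^sub>R J e0 \<in> complex_core" if y: "y \<in> I"
  proof -
    obtain d where d: "J y - d *\<^sub>R e0 \<in> I" using line_complement[OF transversal_outside[OF e0(1)]] by blast
    have "y - (- d) *\<^sub>R J e0 \<in> I" using y e0 subspace_I subspace_diff subspace_scale by blast
    then have "y - (- d) *\<^sub>R J e0 \<in> complex_core"
      using d by (simp add: complex_core_def linear_add[OF linear_J] linear_scale[OF linear_J] J_J)
    then show ?thesis by blast
  qed
qed

text \<open>
  The bracket with \<open>x\<close> acts on the line \<open>I / complex_core\<close> by a scalar \<open>c\<close>, and nilpotency makes
  \<open>c\<close> vanish.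
\<close>

lemma br_transversal_complex_core:
  assumes e0: "e0 - x \<in> I" "J e0 \<in> I"
  shows "br x (J e0) \<in> complex_core"
proof -
  interpret P: commuting_pair complex_core "br x" J by (rule commuting_pair_complex_core)
  obtain c where c: "br x (J e0) - c *\<^sub>R J e0 \<in> complex_core"
    using complex_core_complement(3)[OF e0] br_I[OF e0(2)] by blast
  have pow: "(br x ^^ k) (J e0) - c ^ k *\<^sub>R J e0 \<in> complex_core" for k
  proof (induction k)
    case 0
    then show ?case using subspace_0[OF subspace_complex_core] by simp
  next
    case (Suc k)
    have "br x ((br x ^^ k) (J e0) - c ^ k *\<^sub>R J e0) + c ^ k *\<^sub>R (br x (J e0) - c *\<^sub>R J e0) \<in> complex_core"
      using Suc P.NV c subspace_complex_core by (intro subspace_add subspace_scale) auto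
    then show ?case
      by (simp add: linear_diff[OF linear_br] linear_scale[OF linear_br] scaleR_diff_right mult.commute)
  qed
  obtain K where "\<forall>y. (br x ^^ K) y = 0" using funpow_br_nilpotent by blast
  then have "- (c ^ K *\<^sub>R J e0) \<in> complex_core" using pow[of K] by simp
  then have "c ^ K *\<^sub>R J e0 \<in> complex_core" using subspace_neg[OF subspace_complex_core] by fastforce
  then have "inverse (c ^ K) *\<^sub>R (c ^ K *\<^sub>R J e0) \<in> complex_core" using subspace_scale[OF subspace_complex_core] by blast
  then have "c ^ K = 0" using complex_core_complement(2)[OF e0] by (cases "c ^ K = 0") auto
  then show ?thesis using c by simp
qed

text \<open>
  The data of a normal form: \<open>gs\<close> lists the generators and lengths of the complex Jordan chains, and \<open>b\<close>
  tells whether \<open>J e0\<close> is mapped to the first generator or to \<open>0\<close>.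
\<close>

definition adapted :: "'a \<Rightarrow> bool \<Rightarrow> ('a \<times> nat) list \<Rightarrow> bool" where
  "adapted e0 b gs \<longleftrightarrow> e0 - x \<in> I \<and> J e0 \<in> I \<and>
     jordan_generators (br x) complex_core gs \<and> basis_list complex_core (chains (br x) gs @ map J (chains (br x) gs)) \<and>
     (b \<longrightarrow> gs \<noteq> []) \<and> br x (J e0) = (if b then fst (hd gs) else 0)"

lemma adapted_exists: "\<exists>e0 b gs. adapted e0 b gs"
proof -
  interpret P: commuting_pair complex_core "br x" J by (rule commuting_pair_complex_core)
  obtain e0 where e0: "e0 - x \<in> I" "J e0 \<in> I" using transversal_exists by blast
  obtain T where T: "finite T" "span T = (UNIV :: 'a set)" using finite_dim by blast
  obtain bs where bs: "basis_list complex_core bs" using basis_list_exists[OF subspace_complex_core _ T(1)] T(2) by blast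
  obtain K where K: "\<forall>y. (br x ^^ K) y = 0" using funpow_br_nilpotent by blast
  obtain w gs where w: "w \<in> complex_core" and gs: "jordan_generators (br x) complex_core gs"
    "basis_list complex_core (chains (br x) gs @ map J (chains (br x) gs))"
    and v: "br x (J e0) = br x w \<or> (gs \<noteq> [] \<and> br x (J e0) = fst (hd gs) + br x w)"
    using jordan_basis_for_coset[OF commuting_pair_complex_core bs K[rule_format] br_transversal_complex_core[OF e0]] by metis
  \<comment> \<open>Chosen so that \<open>J f0 = J e0 - w\<close>, which removes the part \<open>br x w\<close>.\<close>
  define f0 where "f0 = e0 + J w"
  have wI: "w \<in> I" "J w \<in> I" using w by (auto simp: complex_core_def)
  have "f0 - x = (e0 - x) + J w" by (simp add: f0_def)
  then have "f0 - x \<in> I" using e0 wI subspace_add[OF subspace_I] by metis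
  moreover have f: "J f0 = J e0 - w" by (simp add: f0_def linear_add[OF linear_J] J_J)
  then have "J f0 \<in> I" using e0 wI subspace_diff[OF subspace_I] by simp
  moreover have "br x (J f0) = br x (J e0) - br x w" by (simp add: f linear_diff[OF linear_br])
  ultimately have "adapted f0 (br x (J f0) \<noteq> 0) gs" using gs v by (auto simp: adapted_def)
  then show ?thesis by blast
qed

lemma adapted_permute:
  assumes a: "adapted e0 b gs" and ns: "mset ns = mset (map snd gs)" "b \<longrightarrow> hd ns = hd (map snd gs)"
  shows "\<exists>gs'. adapted e0 b gs' \<and> map snd gs' = ns"
proof -
  obtain hs where hs: "mset hs = mset gs" "map snd hs = ns" "b \<longrightarrow> hd hs = hd gs"
  proof (cases b)
    case False
    then show thesis using mset_map_eq_lift[OF ns(1)] that by blast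
  next
    case True
    then have "gs \<noteq> []" using a by (simp add: adapted_def)
    then obtain g r where g: "gs = g # r" by (cases gs) auto
    then have "ns \<noteq> []" using ns(1) by auto
    then obtain ns' where ns': "ns = snd g # ns'" using ns(2) True g by (cases ns) auto
    then obtain r' where "mset r' = mset r" "map snd r' = ns'"
      using mset_map_eq_lift[of ns' snd r] ns(1) g by auto
    then show thesis using that[of "g # r'"] g ns' by simp
  qed
  have "set hs = set gs" using hs(1) mset_eq_setD by blast
  moreover have "hs = [] \<longleftrightarrow> gs = []" using hs(1) by auto
  moreover have "mset (chains (br x) hs) = mset (chains (br x) gs)" using hs(1) by (rule mset_chains)
  then have "basis_list complex_core (chains (br x) gs @ map J (chains (br x) gs)) \<Longrightarrow>
      basis_list complex_core (chains (br x) hs @ map J (chains (br x) hs))"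
    by (elim basis_list_mset) simp
  ultimately have "adapted e0 b hs" using a hs(3) unfolding adapted_def jordan_generators_def by simp
  then show ?thesis using hs(2) by blast
qed

lemma adapted_basis_I:
  assumes "adapted e0 b gs"
  shows "basis_list I (J e0 # chains (br x) gs @ map J (chains (br x) gs))"
  using assms complex_core_complement[of e0] unfolding adapted_def
  by (intro basis_list_Cons[of complex_core]) (auto simp: subspace_I complex_core_def)

lemma adapted_basis_UNIV:
  assumes "adapted e0 b gs"
  shows "basis_list UNIV (e0 # J e0 # chains (br x) gs @ map J (chains (br x) gs))"
proof -
  have "e0 \<notin> I" using assms transversal_outside by (simp add: adapted_def)
  show ?thesis
    by (rule basis_list_Cons[OF adapted_basis_I[OF assms]]) (use \<open>e0 \<notin> I\<close> line_complement in auto)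
qed

text \<open>
  The images under \<open>J\<close> of the chains are chains as well. When \<open>b\<close> holds, \<open>J e0\<close> followed by
  the first chain is a single chain, longer by one.
\<close>

lemma adapted_jordan_block_counts:
  assumes a: "adapted e0 b gs"
  shows "jordan_block_counts I (br x) (count_list (real_block_sizes b (map snd gs)))"
proof -
  interpret P: commuting_pair complex_core "br x" J by (rule commuting_pair_complex_core)
  have gs: "jordan_generators (br x) complex_core gs" using a by (simp add: adapted_def)
  define Jgs where "Jgs = map (\<lambda>(u, k). (J u, k)) gs"
  have Jgs: "jordan_generators (br x) complex_core Jgs" "map J (chains (br x) gs) = chains (br x) Jgs" "map snd Jgs = map snd gs"
    using P.jordan_generators_J[OF gs] P.map_J_chains[OF gs] by (auto simp: Jgs_def)
  have sub: "jordan_generators (br x) complex_core hs \<Longrightarrow> jordan_generators (br x) I hs" for hs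
    by (auto simp: jordan_generators_def complex_core_def)
  have e1: "J e0 \<in> I" using a by (simp add: adapted_def)
  note basis = adapted_basis_I[OF a]
  show ?thesis
  proof (cases b)
    case False
    let ?hs = "(J e0, 1) # gs @ Jgs"
    have "br x (J e0) = 0" using a False by (simp add: adapted_def)
    then have "jordan_generators (br x) I ?hs"
      using sub[OF gs] sub[OF Jgs(1)] e1 by (auto simp: jordan_generators_def)
    moreover have "basis_list I (chains (br x) ?hs)" using basis by (simp add: Jgs(2) chain_def)
    ultimately have "jordan_block_counts I (br x) (count_list (map snd ?hs))"
      by (rule jordan_block_counts_chains)
    then show ?thesis using False Jgs(3) by (simp add: real_block_sizes_def)
  next
    case True
    then obtain u k r where r: "gs = (u, k) # r" using a by (cases gs) (auto simp: adapted_def)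
    let ?hs = "(J e0, Suc k) # r @ Jgs"
    have e1u: "br x (J e0) = u" using a True r by (simp add: adapted_def)
    have "(br x ^^ Suc k) (J e0) = (br x ^^ k) u" by (simp only: funpow_Suc_right o_apply e1u)
    then have "(br x ^^ Suc k) (J e0) = 0" using gs r by (simp add: jordan_generators_def)
    then have "jordan_generators (br x) I ?hs"
      using sub[OF gs] sub[OF Jgs(1)] e1 r by (auto simp: jordan_generators_def)
    moreover have "chain (br x) (J e0) (Suc k) = J e0 # chain (br x) u k"
      unfolding chain_def by (simp only: map_upt_Suc funpow_Suc_right o_apply e1u) simp
    then have "basis_list I (chains (br x) ?hs)" using basis by (simp add: Jgs(2) r[symmetric]) (simp add: r)
    ultimately have "jordan_block_counts I (br x) (count_list (map snd ?hs))"
      by (rule jordan_block_counts_chains)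
    moreover have "map snd ?hs = real_block_sizes b (map snd gs)"
      using True Jgs(3) r by (simp add: real_block_sizes_def)
    ultimately show ?thesis by simp
  qed
qed

end

lemma count_real_block_sizes_0: "0 \<notin> set ns \<Longrightarrow> count_list (real_block_sizes b ns) 0 = 0"
  by (cases ns) (auto simp: real_block_sizes_def count_list_0_iff)

lemma represented_by_cong:
  "represented_by N e f M \<Longrightarrow> (\<And>k. k < N \<Longrightarrow> f (e k) = g (e k)) \<Longrightarrow> represented_by N e g M"
  by (auto simp: represented_by_def)

section \<open>Adapted frames and automorphisms\<close>

lemma ad_matrix_represents:
  assumes cs: "represented_by (length cs) ((!) cs) f (four_block_mat B' (0\<^sub>m n n) (0\<^sub>m n n) B')"
    and B': "B' = map_mat real_of_int B"
    and len: "length cs = 2 * n" and f: "f a = (if j > 1 then cs ! 0 else 0)" and n: "j > 1 \<longrightarrow> 0 < n"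
  shows "represented_by (2 * n + 1) ((!) (a # cs)) f (ad_matrix n j B)"
proof -
  let ?v = "mat (2 * n) 1 (\<lambda>(i, _). if i = 0 then if j > 1 then 1 else 0 else 0) :: real mat"
  have "represented_by (length [a] + length cs) ((!) ([a] @ cs)) f
    (four_block_mat (0\<^sub>m 1 1) (0\<^sub>m 1 (2 * n)) ?v (four_block_mat B' (0\<^sub>m n n) (0\<^sub>m n n) B'))"
  proof (rule represented_by_four_block)
    fix k assume "k < length [a]"
    then have k: "k = 0" by simp
    have "(\<Sum>i<length cs. ?v $$ (i, k) *\<^sub>R cs ! i) = (\<Sum>i<2 * n. if i = 0 then (if j > 1 then cs ! 0 else 0) else 0)"
      unfolding len by (rule sum.cong) (auto simp: k)
    also have "\<dots> = f a" using n f by (cases "j > 1") auto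
    finally show "f ([a] ! k) = (\<Sum>i<length [a]. 0\<^sub>m 1 1 $$ (i, k) *\<^sub>R [a] ! i) + (\<Sum>i<length cs. ?v $$ (i, k) *\<^sub>R cs ! i)"
      using k by simp
  next
    fix k assume "k < length cs"
    then show "f (cs ! k) = (\<Sum>i<length [a]. 0\<^sub>m 1 (2 * n) $$ (i, k) *\<^sub>R [a] ! i) +
        (\<Sum>i<length cs. four_block_mat B' (0\<^sub>m n n) (0\<^sub>m n n) B' $$ (i, k) *\<^sub>R cs ! i)"
      using cs len by (simp add: represented_by_def)
  qed (use cs in \<open>simp_all add: represented_by_def\<close>)
  moreover have "length [a] + length cs = 2 * n + 1" using len by simp
  ultimately show ?thesis unfolding ad_matrix_def Let_def B' by simp
qed

lemma J0_matrix_represents: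
  assumes J: "linear J" "\<And>y. J (J y) = - y"
  shows "represented_by (2 * length bs + 2) ((!) (a # J a # bs @ map J bs)) J (J0_matrix (length bs))"
proof -
  let ?n = "length bs"
  have 1: "represented_by (length [a, J a]) ((!) [a, J a]) J (mat_of_rows_list 2 [[0, -1], [1, 0]])"
    unfolding represented_by_def
    by (auto simp: mat_of_rows_list_def J less_Suc_eq numeral_2_eq_2 lessThan_Suc)
  have 2: "represented_by (length bs + length (map J bs)) ((!) (bs @ map J bs)) J
      (four_block_mat (0\<^sub>m ?n ?n) (- 1\<^sub>m ?n) (1\<^sub>m ?n) (0\<^sub>m ?n ?n))"
  proof (rule represented_by_four_block)
    fix k assume k: "k < length bs"
    have "(\<Sum>i<length (map J bs). 1\<^sub>m ?n $$ (i, k) *\<^sub>R map J bs ! i) = (\<Sum>i<?n. if i = k then J (bs ! i) else 0)"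
      using k by (intro sum.cong) auto
    then show "J (bs ! k) = (\<Sum>i<length bs. 0\<^sub>m ?n ?n $$ (i, k) *\<^sub>R bs ! i) +
        (\<Sum>i<length (map J bs). 1\<^sub>m ?n $$ (i, k) *\<^sub>R map J bs ! i)"
      using k by simp
  next
    fix k assume "k < length (map J bs)"
    then have k: "k < ?n" by simp
    have "(\<Sum>i<?n. (- 1\<^sub>m ?n) $$ (i, k) *\<^sub>R bs ! i) = (\<Sum>i<?n. if i = k then - bs ! i else 0)"
      using k by (intro sum.cong) auto
    then show "J (map J bs ! k) = (\<Sum>i<length bs. (- 1\<^sub>m ?n) $$ (i, k) *\<^sub>R bs ! i) +
        (\<Sum>i<length (map J bs). 0\<^sub>m ?n ?n $$ (i, k) *\<^sub>R map J bs ! i)"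
      using k by (simp add: J)
  qed auto
  have "represented_by (length [a, J a] + length (bs @ map J bs)) ((!) ([a, J a] @ bs @ map J bs)) J
      (four_block_mat (mat_of_rows_list 2 [[0, -1], [1, 0]])
        (0\<^sub>m (length [a, J a]) (length (bs @ map J bs))) (0\<^sub>m (length (bs @ map J bs)) (length [a, J a]))
        (four_block_mat (0\<^sub>m ?n ?n) (- 1\<^sub>m ?n) (1\<^sub>m ?n) (0\<^sub>m ?n ?n)))"
    using 2 by (intro represented_by_block_diag[OF 1]) simp
  moreover have "length (bs @ map J bs) = 2 * ?n" "length [a, J a] = 2" "2 * ?n + 2 = 2 + 2 * ?n"
    "[a, J a] @ bs @ map J bs = a # J a # bs @ map J bs" by auto
  ultimately show ?thesis unfolding J0_matrix_def by (simp only:)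
qed

context complex_almost_abelian
begin

lemma adapted_frame:
  assumes a: "adapted e0 b gs" and j: "j > 1 \<longleftrightarrow> b" and n: "n = sum_list (map snd gs)"
  obtains e where "basis_of UNIV (2 * n + 2) e" "I = span (e ` {1..2 * n + 1})"
    "represented_by (2 * n + 1) (\<lambda>i. e (i + 1)) (br (e 0))
       (ad_matrix n j (nilpotent_lower_jordan (map snd gs)))"
    "represented_by (2 * n + 2) e J (J0_matrix n)"
proof -
  interpret P: commuting_pair complex_core "br x" J by (rule commuting_pair_complex_core)
  let ?B = "nilpotent_lower_jordan (map snd gs)"
  define bs where "bs = chains (br x) gs"
  define L where "L = e0 # J e0 # bs @ map J bs"
  have gs: "jordan_generators (br x) complex_core gs" and e0: "e0 - x \<in> I" "J e0 \<in> I"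
    using a by (auto simp: adapted_def)
  have len: "length bs = n" by (simp add: bs_def n length_chains)
  have LI: "basis_list I (tl L)" using adapted_basis_I[OF a] by (simp add: L_def bs_def)
  have LU: "basis_list UNIV L" using adapted_basis_UNIV[OF a] by (simp add: L_def bs_def)
  have lenL: "length L = 2 * n + 2" by (simp add: L_def len)
  have "basis_of UNIV (2 * n + 2) ((!) L)" using basis_list_imp_basis_of[OF LU] lenL by simp
  moreover have "I = span ((!) L ` {1..2 * n + 1})"
  proof -
    have "{1..2 * n + 1} = Suc ` {..<2 * n + 1}" by (simp add: image_Suc_lessThan)
    then have "(!) L ` {1..2 * n + 1} = (\<lambda>i. L ! Suc i) ` {..<2 * n + 1}"
      by (simp only: image_image)
    also have "\<dots> = set (tl L)"
    proof -
      have "L ! Suc i = tl L ! i" for i by (simp add: L_def)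
      then show ?thesis by (auto simp: in_set_conv_nth image_iff lenL)
    qed
    finally show ?thesis using LI by (simp add: basis_list_def)
  qed
  moreover have "represented_by (2 * n + 1) (\<lambda>i. L ! (i + 1)) (br (L ! 0)) (ad_matrix n j ?B)"
  proof -
    let ?B' = "map_mat real_of_int ?B"
    have Jgs: "jordan_generators (br x) complex_core (map (\<lambda>(u, k). (J u, k)) gs)"
      "map J bs = chains (br x) (map (\<lambda>(u, k). (J u, k)) gs)"
      "map snd (map (\<lambda>(u, k). (J u, k)) gs) = map snd gs"
      using P.jordan_generators_J[OF gs] P.map_J_chains[OF gs] by (auto simp: bs_def)
    have r1: "represented_by (length bs) ((!) bs) (br x) ?B'"
      using represented_by_chains[OF gs] by (simp add: bs_def)
    have r2: "represented_by (length (map J bs)) ((!) (map J bs)) (br x) ?B'"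
      using represented_by_chains[OF Jgs(1)] unfolding Jgs(2,3) .
    have r: "represented_by (length (bs @ map J bs)) ((!) (bs @ map J bs)) (br x)
        (four_block_mat ?B' (0\<^sub>m n n) (0\<^sub>m n n) ?B')"
      using represented_by_block_diag[OF r1 r2] len by simp
    have "represented_by (2 * n + 1) ((!) (J e0 # bs @ map J bs)) (br x) (ad_matrix n j ?B)"
    proof (rule ad_matrix_represents[OF r refl])
      show "length (bs @ map J bs) = 2 * n" using len by simp
      have "0 < n \<and> (bs @ map J bs) ! 0 = fst (hd gs)" if b: b
      proof -
        obtain u k gs' where g: "gs = (u, k) # gs'" using a b by (cases gs) (auto simp: adapted_def)
        then have "0 < k" using gs by (simp add: jordan_generators_def)
        then show ?thesis using g by (simp add: bs_def n chain_def nth_append)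
      qed
      then show "br x (J e0) = (if j > 1 then (bs @ map J bs) ! 0 else 0)" "j > 1 \<longrightarrow> 0 < n"
        using a j by (auto simp: adapted_def)
    qed
    then have "represented_by (2 * n + 1) (\<lambda>i. L ! (i + 1)) (br x) (ad_matrix n j ?B)"
      by (simp add: represented_by_def L_def)
    moreover have "L ! (i + 1) \<in> I" if "i < 2 * n + 1" for i
    proof -
      have "tl L ! i \<in> set (tl L)" using that lenL by (intro nth_mem) simp
      then show ?thesis using that lenL LI span_base by (auto simp: nth_tl basis_list_def)
    qed
    ultimately show ?thesis
      using br_transversal[OF e0(1)] by (elim represented_by_cong) (simp add: L_def)
  qed
  moreover have "represented_by (2 * n + 2) ((!) L) J (J0_matrix n)"
    using J0_matrix_represents[OF linear_J J_J, of bs e0] by (simp add: L_def len)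
  ultimately show thesis by (rule that)
qed

lemma adapted_sizes:
  assumes "adapted e0 b gs"
  shows "0 \<notin> set (map snd gs)" "b \<longrightarrow> map snd gs \<noteq> []" "dim (UNIV :: 'a set) = 2 * sum_list (map snd gs) + 2"
proof -
  show "0 \<notin> set (map snd gs)" "b \<longrightarrow> map snd gs \<noteq> []"
    using assms by (auto simp: adapted_def jordan_generators_def)
  show "dim (UNIV :: 'a set) = 2 * sum_list (map snd gs) + 2"
    using basis_list_length[OF adapted_basis_UNIV[OF assms]] by (simp add: length_chains)
qed

text \<open>
  The block counts on \<open>I\<close> fix the flag and the complex block sizes of any adapted family
  up to their order, and every order is realised that keeps a prolonged block first.
\<close>

lemma adapted_with_block_counts:
  assumes "\<forall>i>0. m i = count_list (real_block_sizes b ns) i"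
    and "jordan_block_counts I (br x) m"
    and "0 \<notin> set ns" "b \<longrightarrow> ns \<noteq> []"
  shows "\<exists>e0 gs. adapted e0 b gs \<and> map snd gs = ns"
proof -
  obtain e0 b' gs where a: "adapted e0 b' gs" using adapted_exists by blast
  note sz = adapted_sizes[OF a]
  have "m = count_list (real_block_sizes b' (map snd gs))"
    by (rule jordan_block_counts_unique[OF linear_br assms(2) adapted_jordan_block_counts[OF a]])
  then have "count_list (real_block_sizes b ns) i = count_list (real_block_sizes b' (map snd gs)) i" for i
    using assms(1,3) sz(1) by (cases "i = 0") (simp_all add: count_real_block_sizes_0 del: set_map)
  then have eq: "count_list (real_block_sizes b ns) = count_list (real_block_sizes b' (map snd gs))" by blast
  note d = real_block_sizes_determine[OF eq assms(4,3) sz(2,1)]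
  have "adapted e0 b gs" using a d(1) by simp
  then show ?thesis using adapted_permute[of e0 b gs ns] d by blast
qed

end

lemma represented_by_transport:
  assumes "represented_by n e f A" "represented_by n e' f' A" "linear \<psi>" "\<And>i. i < n \<Longrightarrow> \<psi> (e i) = e' i" "k < n"
  shows "\<psi> (f (e k)) = f' (e' k)"
proof -
  have "\<psi> (f (e k)) = (\<Sum>i<n. A $$ (i, k) *\<^sub>R \<psi> (e i))"
    using assms(1,5) by (simp add: represented_by_def linear_sum[OF assms(3)] linear_scale[OF assms(3)])
  also have "\<dots> = f' (e' k)" using assms(2,4,5) by (simp add: represented_by_def)
  finally show ?thesis .
qed

lemma basis_of_linear_map:
  assumes "basis_of V n e"
  shows "\<exists>\<psi>. linear \<psi> \<and> (\<forall>i<n. \<psi> (e i) = e' i)"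
proof -
  have inj: "inj_on e {..<n}" and ind: "independent (e ` {..<n})" using assms by (auto simp: basis_of_def)
  obtain \<psi> where "linear \<psi>" "\<forall>v\<in>e ` {..<n}. \<psi> v = e' (the_inv_into {..<n} e v)"
    using linear_independent_extend[OF ind, of "\<lambda>v. e' (the_inv_into {..<n} e v)"] by blast
  then show ?thesis using the_inv_into_f_f[OF inj] by auto
qed

lemma automorphism_of_equal_matrices:
  assumes lie: "real_lie_algebra br" and ab: "abelian_on br I" and J: "linear J" "linear J'"
    and e: "basis_of UNIV (m + 1) e" "I = span (e ` {1..m})"
      "represented_by m (\<lambda>i. e (i + 1)) (br (e 0)) A" "represented_by (m + 1) e J M"
    and e': "basis_of UNIV (m + 1) e'" "I = span (e' ` {1..m})"
      "represented_by m (\<lambda>i. e' (i + 1)) (br (e' 0)) A" "represented_by (m + 1) e' J' M"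
  shows "\<exists>\<psi>. lie_automorphism br \<psi> \<and> \<psi> \<circ> J = J' \<circ> \<psi>"
proof -
  have bil: "bilinear br" and alt: "br y y = 0" for y using lie by (auto simp: real_lie_algebra_def)
  have anti: "br y z = - br z y" for y z
  proof -
    have "br (y + z) (y + z) = (br y y + br z z) + (br y z + br z y)"
      by (simp add: bilinear_ladd[OF bil] bilinear_radd[OF bil])
    then have "br y z + br z y = 0" unfolding alt by simp
    then show ?thesis by (rule eq_neg_iff_add_eq_0[THEN iffD2])
  qed
  obtain \<psi> where \<psi>: "linear \<psi>" "\<forall>i<m + 1. \<psi> (e i) = e' i" using basis_of_linear_map[OF e(1)] by blast
  obtain \<theta> where \<theta>: "linear \<theta>" "\<forall>i<m + 1. \<theta> (e' i) = e i" using basis_of_linear_map[OF e'(1)] by blast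
  let ?E = "e ` {..<m + 1}" and ?E' = "e' ` {..<m + 1}"
  have sp: "span ?E = UNIV" "span ?E' = UNIV" using e(1) e'(1) by (simp_all add: basis_of_def)
  have "\<theta> (\<psi> y) = y" for y
    by (rule linear_eq_on_span[OF linear_compose[OF \<psi>(1) \<theta>(1), unfolded o_def] linear_id[unfolded id_def], of ?E])
      (use \<psi>(2) \<theta>(2) sp in auto)
  moreover have "\<psi> (\<theta> y) = y" for y
    by (rule linear_eq_on_span[OF linear_compose[OF \<theta>(1) \<psi>(1), unfolded o_def] linear_id[unfolded id_def], of ?E'])
      (use \<psi>(2) \<theta>(2) sp in auto)
  ultimately have "bij \<psi>" by (intro o_bij[of \<theta>]) (auto simp: fun_eq_iff)
  moreover have "\<psi> (J y) = J' (\<psi> y)" for y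
  proof (rule linear_eq_on_span[of "\<lambda>y. \<psi> (J y)" "\<lambda>y. J' (\<psi> y)" ?E])
    show "linear (\<lambda>y. \<psi> (J y))" using linear_compose[OF J(1) \<psi>(1)] by (simp add: o_def)
    show "linear (\<lambda>y. J' (\<psi> y))" using linear_compose[OF \<psi>(1) J(2)] by (simp add: o_def)
    fix v assume "v \<in> ?E"
    then show "\<psi> (J v) = J' (\<psi> v)"
      using represented_by_transport[OF e(4) e'(4) \<psi>(1)] \<psi>(2) by auto
  qed (unfold sp, rule UNIV_I)
  moreover have "\<psi> (br y z) = br (\<psi> y) (\<psi> z)" for y z
  proof (rule bilinear_eq[of "\<lambda>y z. \<psi> (br y z)" "\<lambda>y z. br (\<psi> y) (\<psi> z)" UNIV ?E UNIV ?E])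
    show "bilinear (\<lambda>y z. \<psi> (br y z))" "bilinear (\<lambda>y z. br (\<psi> y) (\<psi> z))"
      unfolding bilinear_def linear_iff
      by (simp_all add: linear_add[OF \<psi>(1)] linear_scale[OF \<psi>(1)] bilinear_ladd[OF bil]
          bilinear_radd[OF bil] bilinear_lmul[OF bil] bilinear_rmul[OF bil])
    have first: "\<psi> (br (e 0) (e k)) = br (e' 0) (e' k)" if k: "k < m + 1" for k
    proof (cases k)
      case 0
      then show ?thesis by (simp add: alt linear_0[OF \<psi>(1)])
    next
      case (Suc l)
      then show ?thesis
        using represented_by_transport[OF e(3) e'(3) \<psi>(1), of l] \<psi>(2) k by simp
    qed
    have inI: "e k \<in> I" "e' k \<in> I" if "k < m + 1" "k \<noteq> 0" for k
    proof -
      have "k \<in> {1..m}" using that by auto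
      then show "e k \<in> I" "e' k \<in> I"
        using span_base[of "e k" "e ` {1..m}"] span_base[of "e' k" "e' ` {1..m}"] e(2) e'(2) by auto
    qed
    have "\<psi> (br (e i) (e k)) = br (e' i) (e' k)" if ik: "i < m + 1" "k < m + 1" for i k
    proof -
      consider "i = 0" | "k = 0" | "i \<noteq> 0" "k \<noteq> 0" by blast
      then show ?thesis
      proof cases
        case 1 then show ?thesis using first ik by simp
      next
        case 2
        then show ?thesis
          using first[OF ik(1)] anti[of "e i"] anti[of "e' i"] by (simp add: linear_neg[OF \<psi>(1)])
      next
        case 3
        then show ?thesis
          using inI ik ab by (simp add: abelian_on_def linear_0[OF \<psi>(1)])
      qed
    qed
    then show "\<psi> (br u v) = br (\<psi> u) (\<psi> v)" if "u \<in> ?E" "v \<in> ?E" for u v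
      using that \<psi>(2) by auto
  qed (unfold sp, simp_all)
  ultimately show ?thesis
    using \<psi>(1) by (intro exI[of _ \<psi>]) (simp add: lie_automorphism_def fun_eq_iff)
qed

theorem proposition3p5:
  fixes br :: "'a::real_vector \<Rightarrow> 'a \<Rightarrow> 'a"
  assumes "almost_abelian br" and "nilpotent_lie br"
  shows "(\<forall>n I J m q j B.
            dim (UNIV :: 'a set) = 2 * n + 2 \<longrightarrow>
            codim_one_abelian_ideal br I \<longrightarrow>
            complex_structure br J \<longrightarrow>
            jordan_partition br I m \<longrightarrow>
            associated_partition m n q j \<longrightarrow>
            admissible_B q j B \<longrightarrow>
            (\<exists>e. basis_of UNIV (2 * n + 2) e \<and>
                 I = span (e ` {1..2 * n + 1}) \<and>
                 represented_by (2 * n + 1) (\<lambda>i. e (i + 1)) (br (e 0)) (ad_matrix n j B) \<and>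
                 represented_by (2 * n + 2) e J (J0_matrix n))) \<and>
         (\<forall>J J'. complex_structure br J \<longrightarrow> complex_structure br J' \<longrightarrow>
            (\<exists>\<psi>. lie_automorphism br \<psi> \<and> \<psi> \<circ> J = J' \<circ> \<psi>))"
proof -
  have lie: "real_lie_algebra br" and fin: "\<exists>S::'a set. finite S \<and> span S = UNIV"
    using assms(1) by (auto simp: almost_abelian_def)
  have out: "\<exists>x. x \<notin> I" if "codim_one_abelian_ideal br I" for I
  proof (rule ccontr)
    assume "\<not> ?thesis"
    then have "I = UNIV" by blast
    then show False using that by (simp add: codim_one_abelian_ideal_def)
  qed
  have locale_holds: "complex_almost_abelian br I J x"
    if "codim_one_abelian_ideal br I" "complex_structure br J" "x \<notin> I" for I J x
    using that lie fin assms(2) by (intro complex_almost_abelian.intro)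
  show ?thesis
  proof (intro conjI allI impI)
    fix n I J m q j B
    assume dim: "dim (UNIV :: 'a set) = 2 * n + 2" and I: "codim_one_abelian_ideal br I"
      and J: "complex_structure br J" and m: "jordan_partition br I m"
      and q: "associated_partition m n q j" and B: "admissible_B q j B"
    obtain x where x: "x \<notin> I" using out[OF I] by blast
    interpret complex_almost_abelian br I J x by (rule locale_holds[OF I J x])
    obtain ns where ns: "0 \<notin> set ns" "\<forall>i>0. count_list ns i = q i"
      "j > 1 \<longrightarrow> ns \<noteq> [] \<and> hd ns = j - 1" "B = nilpotent_lower_jordan ns"
      using B unfolding admissible_B_def by blast
    have "\<forall>i>0. m i = count_list (real_block_sizes (j > 1) ns) i"
      using associated_partition_real_block_sizes[OF q ns(1-3)] by blast
    moreover have "jordan_block_counts I (br x) m" using m x by (simp add: jordan_partition_def)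
    ultimately obtain e0 gs where a: "adapted e0 (j > 1) gs" "map snd gs = ns"
      using adapted_with_block_counts ns(1,3) by blast
    have "n = sum_list (map snd gs)" using adapted_sizes(3)[OF a(1)] dim by simp
    then obtain e where "basis_of UNIV (2 * n + 2) e" "I = span (e ` {1..2 * n + 1})"
      "represented_by (2 * n + 1) (\<lambda>i. e (i + 1)) (br (e 0)) (ad_matrix n j (nilpotent_lower_jordan (map snd gs)))"
      "represented_by (2 * n + 2) e J (J0_matrix n)"
      by (rule adapted_frame[OF a(1) refl])
    then show "\<exists>e. basis_of UNIV (2 * n + 2) e \<and> I = span (e ` {1..2 * n + 1}) \<and>
        represented_by (2 * n + 1) (\<lambda>i. e (i + 1)) (br (e 0)) (ad_matrix n j B) \<and>
        represented_by (2 * n + 2) e J (J0_matrix n)"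
      unfolding a(2) ns(4) by blast
  next
    fix J J' assume J: "complex_structure br J" and J': "complex_structure br J'"
    obtain I where I: "codim_one_abelian_ideal br I" using assms(1) by (auto simp: almost_abelian_def)
    obtain x where x: "x \<notin> I" using out[OF I] by blast
    interpret C: complex_almost_abelian br I J x by (rule locale_holds[OF I J x])
    interpret C': complex_almost_abelian br I J' x by (rule locale_holds[OF I J' x])
    obtain e0 b gs where a: "C.adapted e0 b gs" using C.adapted_exists by blast
    obtain e0' gs' where a': "C'.adapted e0' b gs'" "map snd gs' = map snd gs"
      using C'.adapted_with_block_counts[OF _ C.adapted_jordan_block_counts[OF a] C.adapted_sizes(1,2)[OF a]]
      by blast
    \<comment> \<open>The matrix depends on \<open>j\<close> only through \<open>j > 1\<close>, so any such value serves.\<close>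
    define n j where "n = sum_list (map snd gs)" and "j = (if b then 2 else 1 :: nat)"
    have j: "j > 1 \<longleftrightarrow> b" by (simp add: j_def)
    obtain e where e: "basis_of UNIV (2 * n + 2) e" "I = span (e ` {1..2 * n + 1})"
      "represented_by (2 * n + 1) (\<lambda>i. e (i + 1)) (br (e 0)) (ad_matrix n j (nilpotent_lower_jordan (map snd gs)))"
      "represented_by (2 * n + 2) e J (J0_matrix n)"
      by (rule C.adapted_frame[OF a j n_def])
    obtain e' where e': "basis_of UNIV (2 * n + 2) e'" "I = span (e' ` {1..2 * n + 1})"
      "represented_by (2 * n + 1) (\<lambda>i. e' (i + 1)) (br (e' 0)) (ad_matrix n j (nilpotent_lower_jordan (map snd gs)))"
      "represented_by (2 * n + 2) e' J' (J0_matrix n)"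
      by (rule C'.adapted_frame[OF a'(1) j n_def[folded a'(2)], unfolded a'(2)])
    have "2 * n + 2 = (2 * n + 1) + 1" by simp
    note e = e[unfolded this] and e' = e'[unfolded this]
    show "\<exists>\<psi>. lie_automorphism br \<psi> \<and> \<psi> \<circ> J = J' \<circ> \<psi>"
      using automorphism_of_equal_matrices[OF lie _ C.linear_J C'.linear_J e e'] I
      by (simp add: codim_one_abelian_ideal_def)
  qed
qed

end
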